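(* Let $\varepsilon\in(0,1]$, let $D\subset\mathbb{C}$ be a domain, let $a\in\partial D$ be a $\mathcal{C}^{1,\varepsilon}$-smooth boundary point of $D$, and let $m_D$ be any one of the functions $\gamma_D,\ \kappa_D,\ \beta_D/\sqrt{2},\ \sqrt{\pi K_D}$ on $D$. Then the function $$\frac{2m_Dd_D-1}{d_D^{\varepsilon}}$$ is bounded near $a$, i.e. there is a neighborhood $U$ of $a$ such that it is bounded on $D\cap U$.
   Context: $\mathbb{D}$ is the open unit disc, $\mathcal{O}(X,Y)$ is the set of holomorphic maps from $X$ to $Y$, and $d_D(z)=\mathrm{dist}(z,\partial D)$. For a domain $D\subset\mathbb{C}$ and $z\in D$ (all metrics are evaluated at the tangent vector $1$): - Carathéodory metric: $\gamma_D(z)=\sup\{|f'(z)|: f\in\mathcal{O}(D,\mathbb{D}),\ f(z)=0\}$. - Kobayashi metric: $\kappa_D(z)=\inf\{|\alpha|:\exists\varphi\in\mathcal{O}(\mathbb{D},D)\text{ with }\varphi(0)=z,\ \alpha\varphi'(0)=1\}$. - Bergman kernel on the diagonal: $K_D(z)=\sup\{|f(z)|^2: f\in L^2_h(D),\ \|f\|_{L^2(D)}\le 1\}$, where $L^2_h(D)$ is the space of square-integrable (with respect to Lebesgue measure) holomorphic functions on $D$. - Bergman metric: $\beta_D(z)=M_D(z)/\sqrt{K_D(z)}$, where $M_D(z)=\sup\{|f'(z)|: f\in L^2_h(D),\ \|f\|_{L^2(D)}\le 1,\ f(z)=0\}$ (defined when $\mathbb{C}\setminus D$ is not polar, in which case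 $K_D>0$). A boundary point $a$ of $D$ is $\mathcal{C}^{1,\varepsilon}$-smooth if $\partial D$ near $a$ is given by a $\mathcal{C}^{1}$ curve $\gamma:[0,1]\to\mathbb{C}$ with $\gamma'\neq 0$ and $\gamma'$ Hölder continuous with exponent $\varepsilon$ (Lipschitz if $\varepsilon=1$), with $D$ lying near $a$ on one side of this curve. *)

theory Defs
  imports "HOL-Complex_Analysis.Complex_Analysis"
begin

definition bdist :: "complex set \<Rightarrow> complex \<Rightarrow> real"
  where "bdist D z = infdist z (frontier D)"

text \<open>
  The infinitesimal metrics below are evaluated at the tangent vector \<open>1\<close>. They are real-valued:
  if \<open>D\<close> is open, \<open>D \<noteq> UNIV\<close> and \<open>z \<in> D\<close>, every supremum is over a nonempty set that is bounded
  above, and the infimum is over a nonempty set of nonnegative reals.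
\<close>

definition caratheodory_metric :: "complex set \<Rightarrow> complex \<Rightarrow> real"
  where "caratheodory_metric D z =
    Sup {cmod (deriv f z) | f. f holomorphic_on D \<and> f ` D \<subseteq> ball 0 1 \<and> f z = 0}"

definition kobayashi_metric :: "complex set \<Rightarrow> complex \<Rightarrow> real"
  where "kobayashi_metric D z =
    Inf {cmod \<alpha> | \<alpha>. \<exists>\<phi>. \<phi> holomorphic_on ball 0 1 \<and> \<phi> ` ball 0 1 \<subseteq> D \<and>
                          \<phi> 0 = z \<and> \<alpha> * deriv \<phi> 0 = 1}"

definition L2h :: "complex set \<Rightarrow> (complex \<Rightarrow> complex) set"
  where "L2h D = {f. f holomorphic_on D \<and> set_integrable lborel D (\<lambda>z. (cmod (f z))\<^sup>2)}"

definition L2_norm_on :: "complex set \<Rightarrow> (complex \<Rightarrow> complex) \<Rightarrow> real"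
  where "L2_norm_on D f = sqrt (LINT z:D|lborel. (cmod (f z))\<^sup>2)"

definition bergman_kernel :: "complex set \<Rightarrow> complex \<Rightarrow> real"
  where "bergman_kernel D z = Sup {(cmod (f z))\<^sup>2 | f. f \<in> L2h D \<and> L2_norm_on D f \<le> 1}"

definition bergman_M :: "complex set \<Rightarrow> complex \<Rightarrow> real"
  where "bergman_M D z = Sup {cmod (deriv f z) | f. f \<in> L2h D \<and> L2_norm_on D f \<le> 1 \<and> f z = 0}"

text \<open>
  Meaningful when the kernel is positive, i.e. when the complement of \<open>D\<close> is not polar; this is
  automatic if the boundary of \<open>D\<close> contains an arc.
\<close>

definition bergman_metric :: "complex set \<Rightarrow> complex \<Rightarrow> real"
  where "bergman_metric D z = bergman_M D z / sqrt (bergman_kernel D z)"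

definition holder_on :: "real \<Rightarrow> real set \<Rightarrow> (real \<Rightarrow> complex) \<Rightarrow> bool"
  where "holder_on \<epsilon> S g \<longleftrightarrow> (\<exists>C. \<forall>s\<in>S. \<forall>t\<in>S. cmod (g s - g t) \<le> C * \<bar>s - t\<bar> powr \<epsilon>)"

text \<open>
  \<open>a\<close> is an interior point of a regular simple arc \<open>\<gamma>\<close> that makes up the boundary of \<open>D\<close> near \<open>a\<close>.
  Continuity of \<open>\<gamma>'\<close> is part of the Hoelder condition. The last clause says that near \<open>a\<close> the
  set \<open>D\<close> lies on the left of \<open>\<gamma>\<close> and not on the right: points slightly to the left along the
  normal \<open>\<i> \<gamma>'(t)\<close> are in \<open>D\<close>, those slightly to the right are not. As there are no boundary
  points near \<open>a\<close> off the arc, each whole side is then in \<open>D\<close> or disjoint from \<open>D\<close>. Choosing the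
  left side is no restriction, since \<open>\<gamma>\<close> may be traversed backwards.
\<close>

definition C1_smooth_boundary_point :: "real \<Rightarrow> complex set \<Rightarrow> complex \<Rightarrow> bool"
  where "C1_smooth_boundary_point \<epsilon> D a \<longleftrightarrow>
    (\<exists>(\<gamma> :: real \<Rightarrow> complex) \<gamma>' U.
       (\<forall>t\<in>{0..1}. (\<gamma> has_vector_derivative \<gamma>' t) (at t within {0..1}) \<and> \<gamma>' t \<noteq> 0) \<and>
       holder_on \<epsilon> {0..1} \<gamma>' \<and>
       inj_on \<gamma> {0..1} \<and>
       a \<in> \<gamma> ` {0<..<1} \<and>
       open U \<and> a \<in> U \<and>
       frontier D \<inter> U = \<gamma> ` {0..1} \<inter> U \<and>
       (\<forall>t\<in>{0..1}. \<gamma> t \<in> U \<longrightarrow>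
          (\<forall>\<^sub>F s in at_right 0. \<gamma> t + of_real s * (\<i> * \<gamma>' t) \<in> D \<and>
                                \<gamma> t - of_real s * (\<i> * \<gamma>' t) \<notin> D)))"

end

theory Submission
  imports Defs
begin

text \<open>
  Write \<open>\<gamma>\<close>, \<open>\<kappa>\<close>, \<open>K\<close>, \<open>M\<close> for the Caratheodory metric, the Kobayashi metric, the Bergman kernel and
  \<open>bergman_M\<close>, all at \<open>z\<close>. They are controlled by injective holomorphic maps. If \<open>\<phi>\<close> maps the unit disc
  injectively into \<open>D\<close> with \<open>\<phi> 0 = z\<close>, and \<open>g\<close> maps \<open>D\<close> injectively into the unit disc with
  \<open>g z = 0\<close>, put \<open>U = 1 / \<bar>\<phi>' 0\<bar>\<close> and \<open>L = \<bar>g' z\<bar>\<close>. Then \<open>\<gamma>\<close>, \<open>\<kappa>\<close> and \<open>sqrt (\<pi> K)\<close> lie in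
  \<open>[L, U]\<close> and \<open>M\<close> lies in \<open>sqrt (2 / \<pi>) [L\<^sup>2, U\<^sup>2]\<close>. For \<open>\<gamma>\<close> and \<open>\<kappa>\<close> this is the Schwarz lemma. For
  \<open>K\<close> and \<open>M\<close> the change of variables formula carries square-integrable functions from \<open>D\<close> to the
  disc by \<open>f \<mapsto> (f \<circ> \<phi>) \<phi>'\<close>, where the mean value property over discs bounds them at the centre,
  and the test functions \<open>g'\<close> and \<open>g g'\<close> give the lower bounds. The quotient \<open>M / sqrt K\<close> is not
  monotone in \<open>D\<close>, but it is squeezed since \<open>M\<close> and \<open>K\<close> are.

  It remains to find \<open>\<phi>\<close> and \<open>g\<close> with \<open>U\<close> and \<open>L\<close> both equal to \<open>(1 + O(d\<^sup>\<epsilon>)) / (2 d)\<close>, where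
  \<open>d\<close> is the distance of \<open>z\<close> to the boundary. Round discs suffice, although for
  \<open>\<epsilon> < 1\<close> there need be no disc that touches the boundary at a given point from inside or outside. Let \<open>p\<close> be
  a nearest boundary point to \<open>z\<close>. In coordinates \<open>(X, Y)\<close> along the normal and the tangent at
  \<open>p\<close>, the boundary satisfies \<open>\<bar>X\<bar> \<le> C \<bar>Y\<bar>\<^bsup>1+\<epsilon>\<^esup>\<close> with \<open>C\<close> independent of \<open>p\<close>
  (\<open>holder_curve_flat_near_point\<close>). The elementary bound
  \<open>\<bar>Y\<bar>\<^bsup>1+\<epsilon>\<^esup> \<le> d\<^bsup>1+\<epsilon>\<^esup> + d\<^bsup>\<epsilon>-1\<^esup> Y\<^sup>2\<close> puts the boundary
  between two parabolas with a gap \<open>\<delta> = C d\<^bsup>1+\<epsilon>\<^esup>\<close> on either side of \<open>p\<close> and radius of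
  curvature \<open>R = d\<^bsup>1-\<epsilon>\<^esup> / (2 C)\<close>. So the discs of radius \<open>R\<close> at distance \<open>\<delta>\<close> from \<open>p\<close> on the two
  sides of the tangent lie in \<open>D\<close> and in its complement (\<open>discs_on_both_sides\<close>). Both \<open>\<delta> / d\<close> and
  \<open>d / R\<close> are of order \<open>d\<^sup>\<epsilon>\<close>, which is exactly the error allowed. A Moebius map onto the inner disc
  serves as \<open>\<phi>\<close>, and an inversion in the outer disc followed by a Moebius map serves as \<open>g\<close>.
\<close>

text \<open>The notation \<open>$\<close> then stands only for the coordinates of vectors.\<close>
unbundle no fps_syntax

section \<open>Change of variables for injective holomorphic maps\<close>

text \<open>
  The isomorphism with the plane of real coordinate pairs preserves Lebesgue measure, and so carries
  the change of variables formula in several real variables over to the complex numbers.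
\<close>
definition cart_to_complex :: "real^2 \<Rightarrow> complex"
  where "cart_to_complex v = Complex (v $ 1) (v $ 2)"

definition complex_to_cart :: "complex \<Rightarrow> real^2"
  where "complex_to_cart z = vector [Re z, Im z]"

lemma cart_to_complex_inverse [simp]: "complex_to_cart (cart_to_complex v) = v"
  by (simp add: cart_to_complex_def complex_to_cart_def vec_eq_iff forall_2)

lemma complex_to_cart_inverse [simp]: "cart_to_complex (complex_to_cart z) = z"
  by (simp add: cart_to_complex_def complex_to_cart_def)

lemma bounded_linear_cart_to_complex: "bounded_linear cart_to_complex"
  unfolding cart_to_complex_def
  by (intro linear_conv_bounded_linear[THEN iffD1] linearI) (auto simp: complex_eq_iff)

lemma bounded_linear_complex_to_cart: "bounded_linear complex_to_cart"
  unfolding complex_to_cart_def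
  by (intro linear_conv_bounded_linear[THEN iffD1] linearI) (auto simp: vec_eq_iff forall_2)

lemma cart_to_complex_measurable [measurable]: "cart_to_complex \<in> borel_measurable borel"
  by (intro borel_measurable_continuous_onI linear_continuous_on bounded_linear_cart_to_complex)

lemma cart_to_complex_vimage: "cart_to_complex -` S = complex_to_cart ` S"
  by (auto intro!: image_eqI[where x = "cart_to_complex _"])

lemma lborel_eq_distr_cart: "lborel = distr lborel borel cart_to_complex"
proof (rule lborel_eqI)
  fix l u :: complex assume le: "\<And>b. b \<in> Basis \<Longrightarrow> l \<bullet> b \<le> u \<bullet> b"
  have "Re l \<le> Re u" "Im l \<le> Im u"
    using le[of 1] le[of \<i>] by (auto simp: Basis_complex_def)
  have eq: "cart_to_complex -` box l u = box (complex_to_cart l) (complex_to_cart u)"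
    by (auto simp: cart_to_complex_def complex_to_cart_def mem_box_cart forall_2 in_box_complex_iff)
  have b: "(Basis :: (real^2) set) = {axis 1 1, axis 2 1}"
    by (auto simp: Basis_vec_def exhaust_2 UNIV_2)
  have "emeasure (distr lborel borel cart_to_complex) (box l u) = emeasure lborel (box (complex_to_cart l) (complex_to_cart u))"
    by (simp add: emeasure_distr eq)
  also have "\<dots> = (\<Prod>b\<in>Basis. (complex_to_cart u - complex_to_cart l) \<bullet> b)"
    using \<open>Re l \<le> Re u\<close> \<open>Im l \<le> Im u\<close>
    by (intro emeasure_lborel_box) (auto simp: b inner_axis complex_to_cart_def)
  also have "\<dots> = (\<Prod>b\<in>Basis. (u - l) \<bullet> b)"
    by (simp add: b inner_axis complex_to_cart_def axis_eq_axis Basis_complex_def)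
  finally show "emeasure (distr lborel borel cart_to_complex) (box l u) = (\<Prod>b\<in>Basis. (u - l) \<bullet> b)" .
qed simp

lemma
  fixes f :: "complex \<Rightarrow> real"
  assumes "open S" "continuous_on S f"
  shows set_integrable_cart: "set_integrable lborel S f \<longleftrightarrow>
      (\<lambda>v. f (cart_to_complex v)) absolutely_integrable_on (complex_to_cart ` S)" (is ?A)
    and set_integral_cart: "set_integrable lborel S f \<Longrightarrow>
      (LINT z:S|lborel. f z) = integral (complex_to_cart ` S) (\<lambda>v. f (cart_to_complex v))" (is "_ \<Longrightarrow> ?B")
proof -
  let ?F = "\<lambda>z. indicator S z *\<^sub>R f z"
  have F [measurable]: "?F \<in> borel_measurable borel"
    using assms by (intro borel_measurable_continuous_on_indicator) auto
  have ind: "indicator S (cart_to_complex v) = indicator (complex_to_cart ` S) v" for v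
    by (metis cart_to_complex_vimage indicator_vimage)
  have 1: "(\<lambda>v. ?F (cart_to_complex v)) \<in> borel_measurable lborel"
    by measurable
  have int: "integrable lborel ?F \<longleftrightarrow> integrable lebesgue (\<lambda>v. ?F (cart_to_complex v))"
    using 1 F by (subst lborel_eq_distr_cart, subst integrable_distr_eq)
      (auto simp: integrable_completion)
  show A: ?A
    unfolding set_integrable_def int by (simp add: ind)
  assume "set_integrable lborel S f"
  with A have abs: "(\<lambda>v. f (cart_to_complex v)) absolutely_integrable_on (complex_to_cart ` S)" by simp
  have "(LINT z:S|lborel. f z) = (LINT v|lborel. ?F (cart_to_complex v))"
    unfolding set_lebesgue_integral_def
    using F by (subst lborel_eq_distr_cart, subst integral_distr) auto
  also have "\<dots> = (LINT v:complex_to_cart ` S|lebesgue. f (cart_to_complex v))"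
    using 1 by (simp add: set_lebesgue_integral_def ind integral_completion)
  also have "\<dots> = integral (complex_to_cart ` S) (\<lambda>v. f (cart_to_complex v))"
    by (rule set_lebesgue_integral_eq_integral(2)[OF abs])
  finally show ?B .
qed

lemma open_complex_to_cart: "open S \<Longrightarrow> open (complex_to_cart ` S)"
  unfolding cart_to_complex_vimage[symmetric]
  by (intro open_vimage linear_continuous_on bounded_linear_cart_to_complex)

text \<open>
  By the Cauchy--Riemann equations the real Jacobian determinant of a holomorphic map is
  \<open>\<bar>g'\<bar>\<^sup>2\<close>. If one side of the second equation is not integrable, then neither is the
  other, and both integrals are \<open>0\<close> by convention.
\<close>
theorem
  fixes f :: "complex \<Rightarrow> real"
  assumes S: "open S" and g: "g holomorphic_on S" and inj: "inj_on g S"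
    and f: "continuous_on (g ` S) f"
  shows set_integrable_holomorphic_image: "set_integrable lborel (g ` S) f \<longleftrightarrow>
      set_integrable lborel S (\<lambda>z. (cmod (deriv g z))\<^sup>2 * f (g z))" (is ?A)
    and set_integral_holomorphic_image: "(LINT z:g ` S|lborel. f z) =
      (LINT z:S|lborel. (cmod (deriv g z))\<^sup>2 * f (g z))" (is ?B)
proof -
  let ?S = "complex_to_cart ` S"
  define G where "G v = complex_to_cart (g (cart_to_complex v))" for v
  define G' where "G' v h = complex_to_cart (deriv g (cart_to_complex v) * cart_to_complex h)" for v h
  have op: "open (g ` S)"
    using open_mapping_thm3[OF g S inj] .
  have der: "(G has_derivative G' v) (at v within ?S)" if "v \<in> ?S" for v
  proof -
    obtain z where z: "z \<in> S" "v = complex_to_cart z" using \<open>v \<in> ?S\<close> by blast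
    have "(g has_derivative (*) (deriv g z)) (at (cart_to_complex v))"
      using g S z by (simp add: holomorphic_derivI has_field_derivative_imp_has_derivative)
    then have "((\<lambda>v. g (cart_to_complex v)) has_derivative (\<lambda>h. deriv g z * cart_to_complex h)) (at v)"
      by (rule has_derivative_compose[rotated])
        (rule bounded_linear_imp_has_derivative[OF bounded_linear_cart_to_complex])
    then have "((\<lambda>v. complex_to_cart (g (cart_to_complex v))) has_derivative
        (\<lambda>h. complex_to_cart (deriv g z * cart_to_complex h))) (at v)"
      by (rule bounded_linear.has_derivative[OF bounded_linear_complex_to_cart])
    then show ?thesis
      by (simp add: G_def[abs_def] G'_def[abs_def] z has_derivative_at_withinI)
  qed
  have det: "\<bar>det (matrix (G' v))\<bar> = (cmod (deriv g (cart_to_complex v)))\<^sup>2" for v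
  proof -
    have "cart_to_complex (axis 1 1) = 1" "cart_to_complex (axis 2 1) = \<i>"
      by (auto simp: cart_to_complex_def axis_def complex_eq_iff)
    then show ?thesis
      by (simp add: det_2 matrix_def G'_def complex_to_cart_def cmod_power2)
        (simp add: power2_eq_square)
  qed
  have img: "G ` ?S = complex_to_cart ` g ` S"
    by (auto simp: G_def image_iff)
  have S_leb: "?S \<in> sets lebesgue"
    using open_complex_to_cart[OF S] by (metis borel_open sets_completionI_sets sets_lborel)
  have "inj_on G ?S"
    using inj by (auto simp: inj_on_def G_def) (metis complex_to_cart_inverse)
  then have *: "(\<lambda>v. \<bar>det (matrix (G' v))\<bar> *\<^sub>R F (G v)) absolutely_integrable_on ?S \<and>
       integral ?S (\<lambda>v. \<bar>det (matrix (G' v))\<bar> *\<^sub>R F (G v)) = b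
     \<longleftrightarrow> F absolutely_integrable_on (G ` ?S) \<and> integral (G ` ?S) F = b"
    for F :: "real^2 \<Rightarrow> real^1" and b
    by (intro has_absolute_integral_change_of_variables der S_leb)
  have **: "(\<lambda>v. (cmod (deriv g (cart_to_complex v)))\<^sup>2 * f (g (cart_to_complex v))) absolutely_integrable_on ?S \<and>
       integral ?S (\<lambda>v. (cmod (deriv g (cart_to_complex v)))\<^sup>2 * f (g (cart_to_complex v))) = b
     \<longleftrightarrow> (\<lambda>v. f (cart_to_complex v)) absolutely_integrable_on (complex_to_cart ` g ` S) \<and>
        integral (complex_to_cart ` g ` S) (\<lambda>v. f (cart_to_complex v)) = b" for b
    using *[of "\<lambda>v. vec (f (cart_to_complex v))" "vec b"]
    unfolding absolutely_integrable_on_1_iff integral_on_1_eq det img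
    by (auto simp: G_def)
  have cont: "continuous_on S (\<lambda>z. (cmod (deriv g z))\<^sup>2 * f (g z))"
    using S g by (intro continuous_intros holomorphic_on_imp_continuous_on holomorphic_deriv
        continuous_on_compose2[OF f]) auto
  show A: ?A
    unfolding set_integrable_cart[OF op f] set_integrable_cart[OF S cont] using ** by blast
  show ?B
  proof (cases "set_integrable lborel (g ` S) f")
    case True
    then show ?thesis
      using A **[of "integral (complex_to_cart ` g ` S) (\<lambda>v. f (cart_to_complex v))"]
      by (simp add: set_integrable_cart[OF op f] set_integral_cart[OF op f]
          set_integrable_cart[OF S cont] set_integral_cart[OF S cont])
  next
    case False
    then show ?thesis
      using A unfolding set_integrable_def set_lebesgue_integral_def
      by (simp add: not_integrable_integral_eq)
  qed
qed

section \<open>Mean values over discs\<close>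

lemma set_integral_mono_subset:
  fixes f :: "'a \<Rightarrow> real"
  assumes "set_integrable M A f" "B \<in> sets M" "B \<subseteq> A" "\<And>x. 0 \<le> f x"
  shows "(LINT x:B|M. f x) \<le> (LINT x:A|M. f x)"
  unfolding set_lebesgue_integral_def
proof (rule integral_mono)
  show "integrable M (\<lambda>x. indicat_real A x *\<^sub>R f x)" "integrable M (\<lambda>x. indicat_real B x *\<^sub>R f x)"
    using assms(1) set_integrable_subset[OF assms(1-3)] by (simp_all add: set_integrable_def)
qed (use assms(3,4) in \<open>auto simp: indicator_def\<close>)

lemma set_integrable_bounded_continuous_ball:
  fixes f :: "complex \<Rightarrow> real"
  assumes "continuous_on (ball c r) f" "\<And>z. z \<in> ball c r \<Longrightarrow> \<bar>f z\<bar> \<le> B"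
  shows "set_integrable lborel (ball c r) f"
  unfolding set_integrable_def
proof (rule integrableI_bounded_set[where A = "ball c r" and B = B])
  show "(\<lambda>z. indicat_real (ball c r) z *\<^sub>R f z) \<in> borel_measurable lborel"
    using borel_measurable_continuous_on_indicator[OF _ assms(1)] by simp
  show "emeasure lborel (ball c r) < \<infinity>"
    using emeasure_bounded_finite[of "ball c r"] by auto
qed (use assms(2) in \<open>auto simp: indicator_def\<close>)

lemma set_integral_const_ball:
  "r \<ge> 0 \<Longrightarrow> (LINT z:ball c r|lborel. K) = K * (pi * r\<^sup>2)" for c :: complex and K :: real
  by (simp add: set_lebesgue_integral_def content_ball unit_ball_vol_2)

lemma set_integral_rotate_ball:
  fixes f :: "complex \<Rightarrow> real"
  assumes "cmod \<omega> = 1" "continuous_on (ball 0 r) f"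
  shows "(LINT z:ball 0 r|lborel. f (\<omega> * z)) = (LINT z:ball 0 r|lborel. f z)"
proof -
  have "(\<lambda>z. \<omega> * z) ` ball 0 r = ball 0 r"
  proof (intro equalityI subsetI)
    fix z :: complex assume z: "z \<in> ball 0 r"
    have "\<omega> \<noteq> 0" using assms(1) by auto
    then show "z \<in> (*) \<omega> ` ball 0 r"
      using z assms(1) by (intro image_eqI[of _ _ "z / \<omega>"]) (auto simp: norm_divide)
  qed (use assms(1) in \<open>auto simp: norm_mult\<close>)
  moreover have "inj_on (\<lambda>z. \<omega> * z) (ball 0 r)"
    using assms(1) by (auto simp: inj_on_def)
  moreover have "deriv (\<lambda>z. \<omega> * z) z = \<omega>" for z
    by (rule DERIV_imp_deriv) (auto intro!: derivative_eq_intros)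
  ultimately show ?thesis
    using set_integral_holomorphic_image[of "ball 0 r" "\<lambda>z. \<omega> * z" f] assms
    by (simp add: holomorphic_on_mult)
qed

text \<open>
  Rotating by an \<open>n\<close>-th root of \<open>-1\<close> changes the sign of the integrand.
\<close>
lemma set_integral_radial_power:
  fixes \<rho> :: "real \<Rightarrow> real"
  assumes "continuous_on UNIV \<rho>" "n > 0"
  shows "(LINT z:ball 0 r|lborel. \<rho> (cmod z) * Re (c * z ^ n)) = 0"
proof -
  define \<omega> where "\<omega> = cis (pi / n)"
  have "\<omega> ^ n = -1"
    using assms(2) by (simp add: \<omega>_def Complex.DeMoivre)
  then have "\<rho> (cmod (\<omega> * z)) * Re (c * (\<omega> * z) ^ n) = - (\<rho> (cmod z) * Re (c * z ^ n))" for z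
    by (simp add: norm_mult power_mult_distrib \<omega>_def algebra_simps)
  moreover have "(LINT z:ball 0 r|lborel. \<rho> (cmod (\<omega> * z)) * Re (c * (\<omega> * z) ^ n)) =
      (LINT z:ball 0 r|lborel. \<rho> (cmod z) * Re (c * z ^ n))"
    by (rule set_integral_rotate_ball[of \<omega> r "\<lambda>z. \<rho> (cmod z) * Re (c * z ^ n)"])
      (auto simp: \<omega>_def intro!: continuous_intros continuous_on_compose2[OF assms(1)])
  ultimately show ?thesis
    by (simp add: set_lebesgue_integral_def)
qed

text \<open>
  On a smaller disc the Taylor polynomials converge uniformly, and every monomial of positive
  degree integrates to zero against a radial weight.
\<close>
lemma set_integral_radial_holomorphic:
  fixes \<rho> :: "real \<Rightarrow> real"
  assumes \<rho>: "continuous_on UNIV \<rho>" and H: "H holomorphic_on ball 0 R" and r: "0 < r" "r < R"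
    and H0: "H 0 = 0"
  shows "(LINT z:ball 0 r|lborel. \<rho> (cmod z) * Re (c * H z)) = 0"
proof -
  have "bounded (\<rho> ` {0..r})"
    by (intro compact_imp_bounded compact_continuous_image continuous_on_subset[OF \<rho>]) auto
  then obtain B where "\<forall>x\<in>\<rho> ` {0..r}. norm x \<le> B"
    unfolding bounded_iff by blast
  then have B: "\<bar>\<rho> t\<bar> \<le> B" if "t \<in> {0..r}" for t
    using that by auto
  \<comment> \<open>The integrand changes by at most \<open>e / (\<pi> r\<^sup>2)\<close> when \<open>H\<close> changes by \<open>e / B'\<close>; the two
    \<open>1\<close> only keep \<open>B'\<close> positive.\<close>
  define B' where "B' = max B 1 * (cmod c + 1) * (pi * r\<^sup>2)"
  have "B' > 0"
    using r by (auto simp: B'_def add_nonneg_pos)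
  have bound: "\<bar>LINT z:ball 0 r|lborel. \<rho> (cmod z) * Re (c * H z)\<bar> \<le> e" if "e > 0" for e
  proof -
    define a where "a k = (deriv ^^ k) H 0 / fact k" for k
    have sums: "(\<lambda>k. a k * z ^ k) sums H z" if "z \<in> ball 0 R" for z
      using holomorphic_power_series[OF H that] by (simp add: a_def)
    have "uniform_limit (cball 0 r) (\<lambda>N z. \<Sum>k<N. a k * z ^ k) H sequentially"
    proof -
      obtain s where s: "r < s" "s < R"
        using r dense by blast
      have "ereal (cmod (complex_of_real s)) \<le> conv_radius a"
        using sums[of "complex_of_real s"] r s by (intro conv_radius_geI) (auto simp: sums_iff)
      then have "ereal r < conv_radius a"
        using r s by (auto intro: less_le_trans[rotated])
      then have "uniform_limit (cball 0 r) (\<lambda>N z. \<Sum>k<N. a k * (z - 0) ^ k) (\<lambda>z. \<Sum>k. a k * (z - 0) ^ k) sequentially"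
        by (rule powser_uniform_limit)
      moreover have "(\<Sum>k. a k * (z - 0) ^ k) = H z" if "z \<in> cball 0 r" for z
        using sums[of z] that r by (auto simp: sums_iff)
      ultimately show ?thesis
        by (simp add: uniform_limit_iff)
    qed
    then have "\<forall>\<^sub>F N in sequentially. \<forall>z\<in>cball 0 r. dist (\<Sum>k<N. a k * z ^ k) (H z) < e / B'"
      using \<open>e > 0\<close> \<open>B' > 0\<close> by (intro uniform_limitD) auto
    then obtain N where N: "\<forall>z\<in>cball 0 r. cmod (H z - (\<Sum>k<N. a k * z ^ k)) < e / B'"
      by (auto simp: dist_norm norm_minus_commute eventually_sequentially)
    let ?P = "\<lambda>z. \<Sum>k<N. a k * z ^ k"
    let ?d = "\<lambda>z. \<rho> (cmod z) * Re (c * (H z - ?P z))"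
    have a0: "a 0 = 0" by (simp add: a_def H0)
    have contH: "continuous_on (ball 0 r) H"
      using H r by (auto intro!: holomorphic_on_imp_continuous_on elim: holomorphic_on_subset)
    have \<rho>': "continuous_on (ball 0 r) (\<lambda>z. \<rho> (cmod z))" for r :: real
      by (auto intro!: continuous_intros continuous_on_compose2[OF \<rho>])
    have term_int: "set_integrable lborel (ball 0 r) (\<lambda>z. \<rho> (cmod z) * Re (c * (a k * z ^ k)))" for k
    proof (rule set_integrable_bounded_continuous_ball)
      show "continuous_on (ball 0 r) (\<lambda>z. \<rho> (cmod z) * Re (c * (a k * z ^ k)))"
        by (auto intro!: continuous_intros \<rho>')
      fix z :: complex assume z: "z \<in> ball 0 r"
      have "\<bar>Re (c * (a k * z ^ k))\<bar> \<le> cmod (c * (a k * z ^ k))"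
        by (rule abs_Re_le_cmod)
      also have "\<dots> \<le> cmod c * (cmod (a k) * r ^ k)"
        using z by (auto simp: norm_mult norm_power intro!: mult_left_mono power_mono)
      finally show "\<bar>\<rho> (cmod z) * Re (c * (a k * z ^ k))\<bar> \<le> B * (cmod c * (cmod (a k) * r ^ k))"
        using B[of "cmod z"] z by (auto simp: abs_mult intro!: mult_mono)
    qed
    have dbound: "\<bar>?d z\<bar> \<le> max B 1 * ((cmod c + 1) * (e / B'))" if z: "z \<in> ball 0 r" for z
    proof -
      have "\<bar>Re (c * (H z - ?P z))\<bar> \<le> cmod (c * (H z - ?P z))"
        by (rule abs_Re_le_cmod)
      also have "\<dots> \<le> (cmod c + 1) * (e / B')"
        using bspec[OF N, of z] z unfolding norm_mult by (intro mult_mono) auto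
      finally have re: "\<bar>Re (c * (H z - ?P z))\<bar> \<le> (cmod c + 1) * (e / B')" .
      have "\<bar>\<rho> (cmod z)\<bar> \<le> max B 1"
        using B[of "cmod z"] z by auto
      then show ?thesis
        unfolding abs_mult by (intro mult_mono re) auto
    qed
    have d_int: "set_integrable lborel (ball 0 r) ?d"
      using dbound
      by (intro set_integrable_bounded_continuous_ball[of _ _ _ "max B 1 * ((cmod c + 1) * (e / B'))"])
        (auto intro!: continuous_intros \<rho>' contH)
    have P_int: "set_integrable lborel (ball 0 r) (\<lambda>z. \<Sum>k<N. \<rho> (cmod z) * Re (c * (a k * z ^ k)))"
      using term_int unfolding set_integrable_def scaleR_sum_right
      by (intro Bochner_Integration.integrable_sum)
    have "(LINT z:ball 0 r|lborel. \<Sum>k<N. \<rho> (cmod z) * Re (c * (a k * z ^ k))) = 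
        (\<Sum>k<N. LINT z:ball 0 r|lborel. \<rho> (cmod z) * Re (c * (a k * z ^ k)))"
      using term_int unfolding set_integrable_def set_lebesgue_integral_def scaleR_sum_right
      by (intro Bochner_Integration.integral_sum)
    also have "\<dots> = 0"
    proof (rule sum.neutral, safe)
      fix k
      show "(LINT z:ball 0 r|lborel. \<rho> (cmod z) * Re (c * (a k * z ^ k))) = 0"
        using set_integral_radial_power[OF \<rho>, of k r "c * a k"] a0
        by (cases "k = 0") (auto simp: mult.assoc)
    qed
    finally have P0: "(LINT z:ball 0 r|lborel. \<Sum>k<N. \<rho> (cmod z) * Re (c * (a k * z ^ k))) = 0" .
    have "(LINT z:ball 0 r|lborel. \<rho> (cmod z) * Re (c * H z)) =
        (LINT z:ball 0 r|lborel. ?d z + (\<Sum>k<N. \<rho> (cmod z) * Re (c * (a k * z ^ k))))"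
      by (rule arg_cong[where f = "set_lebesgue_integral lborel (ball 0 r)"])
        (simp add: fun_eq_iff algebra_simps sum_distrib_left sum_subtractf)
    also have "\<dots> = (LINT z:ball 0 r|lborel. ?d z)"
      using set_integral_add(2)[OF d_int P_int] P0 by simp
    also have "\<bar>\<dots>\<bar> \<le> (LINT z:ball (0::complex) r|lborel. max B 1 * ((cmod c + 1) * (e / B')))"
    proof -
      have "\<bar>LINT z:ball 0 r|lborel. ?d z\<bar> \<le> (LINT z:ball 0 r|lborel. \<bar>?d z\<bar>)"
        using set_integral_norm_bound[OF d_int] by (simp only: real_norm_def)
      also have "\<dots> \<le> (LINT z:ball (0::complex) r|lborel. max B 1 * ((cmod c + 1) * (e / B')))"
      proof (rule set_integral_mono)
        show "set_integrable lborel (ball 0 r) (\<lambda>z. \<bar>?d z\<bar>)"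
          by (rule set_integrable_abs[OF d_int])
        show "set_integrable lborel (ball 0 r) (\<lambda>z::complex. max B 1 * ((cmod c + 1) * (e / B')))"
          by (rule set_integrable_bounded_continuous_ball[OF _ order_refl]) auto
      qed (rule dbound)
      finally show ?thesis .
    qed
    also have "\<dots> = e"
      using r \<open>B' > 0\<close> by (subst set_integral_const_ball) (auto simp: B'_def field_simps)
    finally show ?thesis .
  qed
  have "\<bar>LINT z:ball 0 r|lborel. \<rho> (cmod z) * Re (c * H z)\<bar> \<le> 0"
  proof (rule field_le_epsilon)
    show "\<bar>LINT z:ball 0 r|lborel. \<rho> (cmod z) * Re (c * H z)\<bar> \<le> 0 + e" if "e > 0" for e
      unfolding add_0 by (rule bound[OF that])
  qed
  then show ?thesis
    unfolding abs_le_zero_iff .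
qed

text \<open>
  Expanding \<open>\<bar>H z\<bar>\<^sup>2\<close> around \<open>H 0\<close> gives \<open>\<bar>H z\<bar>\<^sup>2 \<ge> \<bar>H 0\<bar>\<^sup>2 + 2 Re (cnj (H 0) (H z - H 0))\<close>, and the last
  term has weighted mean zero.
\<close>
lemma radial_mean_value_inequality:
  fixes \<rho> :: "real \<Rightarrow> real"
  assumes \<rho>: "continuous_on UNIV \<rho>" "\<And>t. \<rho> t \<ge> 0"
    and H: "H holomorphic_on ball 0 R" and r: "0 < r" "r < R"
  shows "(cmod (H 0))\<^sup>2 * (LINT z:ball 0 r|lborel. \<rho> (cmod z)) \<le>
      (LINT z:ball 0 r|lborel. \<rho> (cmod z) * (cmod (H z))\<^sup>2)"
proof -
  have H': "H holomorphic_on cball 0 r"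
    using H r by (auto elim!: holomorphic_on_subset)
  have int: "set_integrable lborel (ball 0 r) f" if f: "continuous_on (cball 0 r) f" for f :: "complex \<Rightarrow> real"
  proof -
    have "bounded (f ` cball 0 r)"
      by (intro compact_imp_bounded compact_continuous_image f) auto
    then obtain B where "\<forall>x\<in>f ` cball 0 r. norm x \<le> B"
      unfolding bounded_iff by blast
    then show ?thesis
      by (intro set_integrable_bounded_continuous_ball[where B = B] continuous_on_subset[OF f]) auto
  qed
  have c: "continuous_on (cball 0 r) H" "continuous_on (cball 0 r) (\<lambda>z. \<rho> (cmod z))"
    using H' by (auto intro!: holomorphic_on_imp_continuous_on continuous_intros continuous_on_compose2[OF \<rho>(1)])
  have "(LINT z:ball 0 r|lborel. (cmod (H 0))\<^sup>2 * \<rho> (cmod z) + \<rho> (cmod z) * Re (2 * cnj (H 0) * (H z - H 0)))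
      \<le> (LINT z:ball 0 r|lborel. \<rho> (cmod z) * (cmod (H z))\<^sup>2)"
  proof (intro set_integral_mono int continuous_intros c)
    fix z
    have "(cmod (H 0))\<^sup>2 + Re (2 * cnj (H 0) * (H z - H 0)) \<le> (cmod (H z))\<^sup>2"
      using sum_power2_ge_zero[of "Re (H z - H 0)" "Im (H z - H 0)"]
      unfolding cmod_power2 by (simp add: power2_eq_square algebra_simps)
    from mult_left_mono[OF this \<rho>(2)[of "cmod z"]]
    show "(cmod (H 0))\<^sup>2 * \<rho> (cmod z) + \<rho> (cmod z) * Re (2 * cnj (H 0) * (H z - H 0)) \<le> \<rho> (cmod z) * (cmod (H z))\<^sup>2"
      by (simp add: algebra_simps)
  qed
  moreover have "(LINT z:ball 0 r|lborel. (cmod (H 0))\<^sup>2 * \<rho> (cmod z) + \<rho> (cmod z) * Re (2 * cnj (H 0) * (H z - H 0))) =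
      (LINT z:ball 0 r|lborel. (cmod (H 0))\<^sup>2 * \<rho> (cmod z)) + (LINT z:ball 0 r|lborel. \<rho> (cmod z) * Re (2 * cnj (H 0) * (H z - H 0)))"
    by (intro set_integral_add int continuous_intros c)
  moreover have "(LINT z:ball 0 r|lborel. \<rho> (cmod z) * Re (2 * cnj (H 0) * (H z - H 0))) = 0"
    by (intro set_integral_radial_holomorphic[OF \<rho>(1) _ r]) (auto intro!: holomorphic_intros H)
  ultimately show ?thesis by simp
qed

lemma set_integrable_const_ball: "set_integrable lborel (ball c r) (\<lambda>z. K)" for c :: complex and K :: real
  by (rule set_integrable_bounded_continuous_ball[where B = "\<bar>K\<bar>"]) auto

lemma set_integrable_cmod_square_ball: "set_integrable lborel (ball 0 r) (\<lambda>z. (cmod z)\<^sup>2)"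
proof (rule set_integrable_bounded_continuous_ball)
  fix z :: complex assume "z \<in> ball 0 r"
  then show "\<bar>(cmod z)\<^sup>2\<bar> \<le> r\<^sup>2"
    by (simp add: power_mono)
qed (intro continuous_intros)

text \<open>
  With \<open>I r\<close> for the integral, scaling gives \<open>I r = r\<^sup>4 I 1\<close>. On the annulus
  \<open>r \<le> \<bar>z\<bar> < 1\<close> the integrand lies between \<open>r\<^sup>2\<close> and \<open>1\<close>, so \<open>I 1 (1 - r\<^sup>4)\<close> lies between
  \<open>r\<^sup>2\<close> times and once the area \<open>\<pi> (1 - r\<^sup>2)\<close>. Dividing by \<open>1 - r\<^sup>2\<close> and letting \<open>r\<close> tend to \<open>1\<close>
  yields \<open>2 I 1 = \<pi>\<close>.
\<close>
lemma set_integral_cmod_square_ball: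
  assumes "r \<ge> 0"
  shows "(LINT z:ball 0 r|lborel. (cmod z)\<^sup>2) = pi * r ^ 4 / 2"
proof -
  define I where "I r = (LINT z:ball 0 r|lborel. (cmod z)\<^sup>2)" for r
  have scale: "I r = r ^ 4 * I 1" if r: "r > 0" for r
  proof -
    have "(\<lambda>z. of_real r * z) ` ball 0 1 = ball (0::complex) r"
    proof (intro equalityI subsetI)
      fix z :: complex assume "z \<in> ball 0 r"
      then show "z \<in> (*) (of_real r) ` ball 0 1"
        using r by (intro image_eqI[of _ _ "z / of_real r"]) (auto simp: norm_divide)
    qed (use r in \<open>auto simp: norm_mult\<close>)
    moreover have "inj_on (\<lambda>z. of_real r * z) (ball (0::complex) 1)"
      using r by (auto simp: inj_on_def)
    moreover have "deriv (\<lambda>z. of_real r * z) z = of_real r" for z :: complex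
      by (rule DERIV_imp_deriv) (auto intro!: derivative_eq_intros)
    ultimately have "I r = (LINT z:ball 0 1|lborel. r\<^sup>2 * (r * cmod z)\<^sup>2)"
      using set_integral_holomorphic_image[of "ball 0 1" "\<lambda>z. of_real r * z" "\<lambda>z. (cmod z)\<^sup>2"] r
      by (simp add: I_def holomorphic_on_mult norm_mult continuous_on_power continuous_on_norm_id)
    also have "\<dots> = r ^ 4 * I 1"
    proof -
      have "r\<^sup>2 * (r * cmod z)\<^sup>2 = r ^ 4 * (cmod z)\<^sup>2" for z
        by (simp add: power_mult_distrib flip: power_add mult.assoc)
      then show ?thesis
        by (simp only: I_def set_integral_mult_right)
    qed
    finally show ?thesis .
  qed
  have bounds: "I 1 * (1 + r\<^sup>2) \<le> pi \<and> pi * r\<^sup>2 \<le> I 1 * (1 + r\<^sup>2)" if r: "0 < r" "r < 1" for r :: real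
  proof -
    define A where "A = ball (0::complex) 1 - ball 0 r"
    have Un: "ball 0 1 = ball (0::complex) r \<union> A" "ball (0::complex) r \<inter> A = {}"
      using r by (auto simp: A_def)
    have subA: "set_integrable lborel A f" if "set_integrable lborel (ball 0 1) f" for f :: "complex \<Rightarrow> real"
      by (rule set_integrable_subset[OF that]) (auto simp: A_def)
    have split: "(LINT z:ball 0 1|lborel. f z) = (LINT z:ball 0 r|lborel. f z) + (LINT z:A|lborel. f z)"
      if f: "set_integrable lborel (ball 0 1) f" for f :: "complex \<Rightarrow> real"
      unfolding Un(1) using r
      by (intro set_integral_Un[OF Un(2)] subA f set_integrable_subset[OF f]) auto
    have area: "(LINT z:A|lborel. K) = K * (pi * (1 - r\<^sup>2))" for K
      using split[OF set_integrable_const_ball, of K] r by (simp add: set_integral_const_ball algebra_simps)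
    have J: "(LINT z:A|lborel. (cmod z)\<^sup>2) = I 1 * (1 - r ^ 4)"
      using split[OF set_integrable_cmod_square_ball] scale[OF r(1)] by (simp add: I_def algebra_simps)
    have "(LINT z:A|lborel. (cmod z)\<^sup>2) \<le> (LINT z:A|lborel. 1)"
      by (intro set_integral_mono subA set_integrable_cmod_square_ball set_integrable_const_ball)
        (auto simp: A_def power_le_one)
    moreover have "(LINT z:A|lborel. r\<^sup>2) \<le> (LINT z:A|lborel. (cmod z)\<^sup>2)"
      using r by (intro set_integral_mono subA set_integrable_cmod_square_ball set_integrable_const_ball)
        (auto simp: A_def power_mono)
    ultimately have 1: "I 1 * (1 - r ^ 4) \<le> pi * (1 - r\<^sup>2)" "r\<^sup>2 * (pi * (1 - r\<^sup>2)) \<le> I 1 * (1 - r ^ 4)"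
      by (simp_all add: area J)
    have 2: "1 - r\<^sup>2 > 0" using r by (simp add: power_less_one_iff)
    have 3: "1 - r ^ 4 = (1 - r\<^sup>2) * (1 + r\<^sup>2)"
      by (simp add: algebra_simps flip: power_add)
    from 1 have "(1 - r\<^sup>2) * (I 1 * (1 + r\<^sup>2)) \<le> (1 - r\<^sup>2) * pi" "(1 - r\<^sup>2) * (pi * r\<^sup>2) \<le> (1 - r\<^sup>2) * (I 1 * (1 + r\<^sup>2))"
      unfolding 3 by (simp_all add: mult_ac)
    with 2 show ?thesis by simp
  qed
  have ev: "\<forall>\<^sub>F r in at_left (1::real). 0 < r \<and> r < 1"
    using eventually_at_left_real[of 0 "1::real"] by (auto elim: eventually_mono)
  have lim: "((\<lambda>r. I 1 * (1 + r\<^sup>2)) \<longlongrightarrow> I 1 * (1 + 1\<^sup>2)) (at_left 1)"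
    "((\<lambda>r. pi * r\<^sup>2) \<longlongrightarrow> pi * 1\<^sup>2) (at_left (1::real))"
    by (intro tendsto_intros)+
  have "I 1 * (1 + 1\<^sup>2) \<le> pi"
    by (rule tendsto_upperbound[OF lim(1)]) (auto intro: eventually_mono[OF ev] dest: bounds)
  moreover have "pi * 1\<^sup>2 \<le> I 1 * (1 + 1\<^sup>2)"
    by (rule tendsto_le[OF _ lim]) (auto intro: eventually_mono[OF ev] dest: bounds)
  ultimately have "I 1 = pi / 2" by simp
  then show ?thesis
    using scale[of r] assms by (cases "r = 0") (auto simp: I_def set_lebesgue_integral_def)
qed

lemma weighted_mean_value_unit_disc:
  fixes \<rho> :: "real \<Rightarrow> real"
  assumes \<rho>: "continuous_on UNIV \<rho>" "\<And>t. \<rho> t \<ge> 0"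
    and H: "H holomorphic_on ball 0 1" and r: "0 < r" "r < 1"
    and int: "set_integrable lborel (ball 0 1) (\<lambda>z. \<rho> (cmod z) * (cmod (H z))\<^sup>2)"
    and le: "(LINT z:ball 0 1|lborel. \<rho> (cmod z) * (cmod (H z))\<^sup>2) \<le> 1"
  shows "(cmod (H 0))\<^sup>2 * (LINT z:ball 0 r|lborel. \<rho> (cmod z)) \<le> 1"
proof -
  have "(cmod (H 0))\<^sup>2 * (LINT z:ball 0 r|lborel. \<rho> (cmod z)) \<le>
      (LINT z:ball 0 r|lborel. \<rho> (cmod z) * (cmod (H z))\<^sup>2)"
    by (rule radial_mean_value_inequality[OF \<rho> H r])
  also have "\<dots> \<le> (LINT z:ball 0 1|lborel. \<rho> (cmod z) * (cmod (H z))\<^sup>2)"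
    using r \<rho> by (intro set_integral_mono_subset[OF int]) auto
  finally show ?thesis using le by simp
qed

lemma le_of_times_power_le:
  fixes c :: real
  assumes "\<And>r. 0 < r \<Longrightarrow> r < 1 \<Longrightarrow> c * r ^ n \<le> b"
  shows "c \<le> b"
proof -
  have ev: "\<forall>\<^sub>F r in at_left (1::real). 0 < r \<and> r < 1"
    using eventually_at_left_real[of 0 "1::real"] by (auto elim: eventually_mono)
  have lim: "((\<lambda>r. c * r ^ n) \<longlongrightarrow> c * 1 ^ n) (at_left 1)"
    by (intro tendsto_intros)
  have "c * 1 ^ n \<le> b"
    by (rule tendsto_upperbound[OF lim]) (auto intro: eventually_mono[OF ev] dest: assms)
  then show ?thesis by simp
qed

text \<open>
  The mean value inequality for \<open>F\<close> with weight \<open>1\<close>, and for \<open>F z / z\<close> with weight \<open>\<bar>z\<bar>\<^sup>2\<close>. The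
  constants \<open>1 / \<pi>\<close> and \<open>2 / \<pi>\<close> are sharp: they are the values of the Bergman kernel and of the square of
  \<open>M\<close> of the unit disc at the origin.
\<close>
lemma
  assumes F: "F holomorphic_on ball 0 1"
    and int: "set_integrable lborel (ball 0 1) (\<lambda>z. (cmod (F z))\<^sup>2)"
    and le: "(LINT z:ball 0 1|lborel. (cmod (F z))\<^sup>2) \<le> 1"
  shows cmod_square_center_le: "(cmod (F 0))\<^sup>2 \<le> 1 / pi"
    and cmod_deriv_square_center_le: "F 0 = 0 \<Longrightarrow> (cmod (deriv F 0))\<^sup>2 \<le> 2 / pi"
proof -
  have "(cmod (F 0))\<^sup>2 * pi * r\<^sup>2 \<le> 1" if "0 < r" "r < 1" for r
    using weighted_mean_value_unit_disc[of "\<lambda>_. 1" F r] F int le that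
    by (simp add: set_integral_const_ball mult.assoc)
  then have "(cmod (F 0))\<^sup>2 * pi \<le> 1"
    by (rule le_of_times_power_le)
  then show "(cmod (F 0))\<^sup>2 \<le> 1 / pi"
    by (simp add: field_simps)
  assume F0: "F 0 = 0"
  define H where "H = (\<lambda>z. if z = 0 then deriv F 0 else (F z - F 0) / (z - 0))"
  have H: "H holomorphic_on ball 0 1"
    unfolding H_def by (rule pole_lemma[OF F]) auto
  have FH: "(cmod z)\<^sup>2 * (cmod (H z))\<^sup>2 = (cmod (F z))\<^sup>2" for z
    by (simp add: H_def F0 norm_divide power_divide)
  have "(cmod (H 0))\<^sup>2 * (pi / 2) * r ^ 4 \<le> 1" if "0 < r" "r < 1" for r
    using weighted_mean_value_unit_disc[of "\<lambda>t. t\<^sup>2" H r] H int le that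
    by (simp add: FH set_integral_cmod_square_ball mult.assoc continuous_intros)
  then have "(cmod (H 0))\<^sup>2 * (pi / 2) \<le> 1"
    by (rule le_of_times_power_le)
  then show "(cmod (deriv F 0))\<^sup>2 \<le> 2 / pi"
    by (simp add: H_def field_simps)
qed

section \<open>Comparison with the unit disc\<close>

text \<open>
  The pulled-back function \<open>F = (f \<circ> \<phi>) \<phi>'\<close> has on the disc the \<open>L\<^sup>2\<close> norm that \<open>f\<close> has on the image of
  \<open>\<phi>\<close>, hence norm at most \<open>1\<close>. If \<open>f\<close> vanishes at \<open>\<phi> 0\<close>, then \<open>F' 0 = f' (\<phi> 0) (\<phi>' 0)\<^sup>2\<close>.
\<close>
lemma
  assumes D: "open D" and \<phi>: "\<phi> holomorphic_on ball 0 1" "inj_on \<phi> (ball 0 1)" "\<phi> ` ball 0 1 \<subseteq> D"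
    and f: "f \<in> L2h D" "L2_norm_on D f \<le> 1"
  shows L2h_value_le: "(cmod (f (\<phi> 0)) * cmod (deriv \<phi> 0))\<^sup>2 \<le> 1 / pi"
    and L2h_deriv_le: "f (\<phi> 0) = 0 \<Longrightarrow> (cmod (deriv f (\<phi> 0)) * (cmod (deriv \<phi> 0))\<^sup>2)\<^sup>2 \<le> 2 / pi"
proof -
  define F where "F w = f (\<phi> w) * deriv \<phi> w" for w
  have f': "f holomorphic_on D" "set_integrable lborel D (\<lambda>z. (cmod (f z))\<^sup>2)"
    using f by (auto simp: L2h_def)
  have f\<phi>: "(\<lambda>w. f (\<phi> w)) holomorphic_on ball 0 1"
    using holomorphic_on_compose_gen[OF \<phi>(1) f'(1) \<phi>(3)] by (simp add: o_def)
  have F: "F holomorphic_on ball 0 1"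
    unfolding F_def by (intro holomorphic_intros holomorphic_deriv f\<phi> \<phi>) auto
  have op: "open (\<phi> ` ball 0 1)"
    using open_mapping_thm3[OF \<phi>(1) _ \<phi>(2)] by auto
  have cont: "continuous_on (\<phi> ` ball 0 1) (\<lambda>z. (cmod (f z))\<^sup>2)"
    using f'(1) \<phi>(3) by (intro continuous_intros holomorphic_on_imp_continuous_on) (rule holomorphic_on_subset)
  have intf: "set_integrable lborel (\<phi> ` ball 0 1) (\<lambda>z. (cmod (f z))\<^sup>2)"
    using op by (intro set_integrable_subset[OF f'(2) _ \<phi>(3)]) auto
  have eq: "(cmod (F w))\<^sup>2 = (cmod (deriv \<phi> w))\<^sup>2 * (cmod (f (\<phi> w)))\<^sup>2" for w
    by (simp add: F_def norm_mult power_mult_distrib)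
  have int: "set_integrable lborel (ball 0 1) (\<lambda>w. (cmod (F w))\<^sup>2)"
    using set_integrable_holomorphic_image[OF _ \<phi>(1,2) cont] intf by (simp add: eq)
  have "(LINT w:ball 0 1|lborel. (cmod (F w))\<^sup>2) = (LINT z:\<phi> ` ball 0 1|lborel. (cmod (f z))\<^sup>2)"
    using set_integral_holomorphic_image[OF _ \<phi>(1,2) cont] by (simp add: eq)
  also have "\<dots> \<le> (LINT z:D|lborel. (cmod (f z))\<^sup>2)"
    using op by (intro set_integral_mono_subset[OF f'(2)] \<phi>(3)) auto
  also have "\<dots> \<le> 1"
    using f(2) by (simp add: L2_norm_on_def)
  finally have le: "(LINT w:ball 0 1|lborel. (cmod (F w))\<^sup>2) \<le> 1" .
  show "(cmod (f (\<phi> 0)) * cmod (deriv \<phi> 0))\<^sup>2 \<le> 1 / pi"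
    using cmod_square_center_le[OF F int le] by (simp add: F_def norm_mult)
  assume f0: "f (\<phi> 0) = 0"
  have "\<phi> 0 \<in> D" using \<phi>(3) by auto
  have d\<phi>: "(\<phi> has_field_derivative deriv \<phi> 0) (at 0)"
    by (rule holomorphic_derivI[OF \<phi>(1)]) auto
  have "((\<lambda>w. f (\<phi> w)) has_field_derivative deriv f (\<phi> 0) * deriv \<phi> 0) (at 0)"
    by (rule DERIV_chain2[OF holomorphic_derivI[OF f'(1) D \<open>\<phi> 0 \<in> D\<close>] d\<phi>])
  moreover have "(deriv \<phi> has_field_derivative deriv (deriv \<phi>) 0) (at 0)"
    by (rule holomorphic_derivI[OF holomorphic_deriv[OF \<phi>(1)]]) auto
  ultimately have "(F has_field_derivative deriv f (\<phi> 0) * deriv \<phi> 0 * deriv \<phi> 0) (at 0)"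
    unfolding F_def[abs_def] by (auto intro!: derivative_eq_intros simp: f0)
  then have "deriv F 0 = deriv f (\<phi> 0) * deriv \<phi> 0 * deriv \<phi> 0"
    by (rule DERIV_imp_deriv)
  moreover have "F 0 = 0" by (simp add: F_def f0)
  ultimately show "(cmod (deriv f (\<phi> 0)) * (cmod (deriv \<phi> 0))\<^sup>2)\<^sup>2 \<le> 2 / pi"
    using cmod_deriv_square_center_le[OF F int le] by (simp add: norm_mult power2_eq_square mult_ac)
qed

text \<open>
  This is the Schwarz lemma for \<open>f \<circ> \<phi>\<close>. It bounds the Caratheodory metric from above when \<open>\<phi>\<close> is
  fixed, and the Kobayashi metric from below when \<open>f\<close> is fixed.
\<close>
lemma caratheodory_candidate_le:
  assumes D: "open D" and \<phi>: "\<phi> holomorphic_on ball 0 1" "\<phi> ` ball 0 1 \<subseteq> D"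
    and f: "f holomorphic_on D" "f ` D \<subseteq> ball 0 1" "f (\<phi> 0) = 0"
  shows "cmod (deriv f (\<phi> 0)) * cmod (deriv \<phi> 0) \<le> 1"
proof -
  have "\<phi> 0 \<in> D" using \<phi>(2) by auto
  have "((\<lambda>w. f (\<phi> w)) has_field_derivative deriv f (\<phi> 0) * deriv \<phi> 0) (at 0)"
    by (rule DERIV_chain2[OF holomorphic_derivI[OF f(1) D \<open>\<phi> 0 \<in> D\<close>] holomorphic_derivI[OF \<phi>(1)]]) auto
  then have "deriv (\<lambda>w. f (\<phi> w)) 0 = deriv f (\<phi> 0) * deriv \<phi> 0"
    by (rule DERIV_imp_deriv)
  moreover have "(\<lambda>w. f (\<phi> w)) holomorphic_on ball 0 1"
    using holomorphic_on_compose_gen[OF \<phi>(1) f(1) \<phi>(2)] by (simp add: o_def)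
  moreover have "cmod (f (\<phi> w)) < 1" if "cmod w < 1" for w
  proof -
    have "\<phi> w \<in> D" using \<phi>(2) that by auto
    then show ?thesis using f(2) by auto
  qed
  ultimately show ?thesis
    using Schwarz_Lemma(2)[of "\<lambda>w. f (\<phi> w)" 0] f(3) by (simp add: norm_mult)
qed

text \<open>
  The test functions for the lower bounds on the Bergman kernel and on \<open>M\<close>: the pull-backs by \<open>g\<close>
  of the extremal functions \<open>sqrt (1 / \<pi>)\<close> and \<open>sqrt (2 / \<pi>) w\<close> of the unit disc.
\<close>
lemma
  assumes D: "open D" and g: "g holomorphic_on D" "inj_on g D" "g ` D \<subseteq> ball 0 1"
  shows deriv_in_L2h: "(\<lambda>w. of_real (1 / sqrt pi) * deriv g w) \<in> L2h D"
    and L2_norm_deriv_le: "L2_norm_on D (\<lambda>w. of_real (1 / sqrt pi) * deriv g w) \<le> 1"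
    and times_deriv_in_L2h: "(\<lambda>w. of_real (sqrt (2 / pi)) * (g w * deriv g w)) \<in> L2h D"
    and L2_norm_times_deriv_le: "L2_norm_on D (\<lambda>w. of_real (sqrt (2 / pi)) * (g w * deriv g w)) \<le> 1"
proof -
  have op: "open (g ` D)"
    using open_mapping_thm3[OF g(1) D g(2)] .
  have *: "set_integrable lborel D (\<lambda>z. (cmod (deriv g z))\<^sup>2 * f (g z)) \<and>
      (LINT z:D|lborel. (cmod (deriv g z))\<^sup>2 * f (g z)) \<le> (LINT z:ball 0 1|lborel. f z)"
    if f: "continuous_on UNIV f" "set_integrable lborel (ball 0 1) f" "\<And>z. f z \<ge> 0" for f :: "complex \<Rightarrow> real"
  proof -
    have c: "continuous_on (g ` D) f"
      using f(1) continuous_on_subset by blast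
    have "set_integrable lborel (g ` D) f"
      using op by (intro set_integrable_subset[OF f(2) _ g(3)]) auto
    moreover have "(LINT z:g ` D|lborel. f z) \<le> (LINT z:ball 0 1|lborel. f z)"
      using op by (intro set_integral_mono_subset[OF f(2)] g(3) f(3)) auto
    ultimately show ?thesis
      using set_integrable_holomorphic_image[OF D g(1,2) c] set_integral_holomorphic_image[OF D g(1,2) c]
      by simp
  qed
  have g': "deriv g holomorphic_on D"
    by (rule holomorphic_deriv[OF g(1) D])
  have 1: "set_integrable lborel D (\<lambda>z. (cmod (deriv g z))\<^sup>2)"
    "(LINT z:D|lborel. (cmod (deriv g z))\<^sup>2) \<le> pi"
    using *[of "\<lambda>_. 1"] by (auto simp: set_integrable_const_ball set_integral_const_ball)
  have 2: "set_integrable lborel D (\<lambda>z. (cmod (deriv g z))\<^sup>2 * (cmod (g z))\<^sup>2)"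
    "(LINT z:D|lborel. (cmod (deriv g z))\<^sup>2 * (cmod (g z))\<^sup>2) \<le> pi / 2"
    using *[of "\<lambda>w. (cmod w)\<^sup>2"] set_integrable_cmod_square_ball[of 1] set_integral_cmod_square_ball[of 1]
    by (auto intro!: continuous_intros)
  have e1: "(cmod (of_real (1 / sqrt pi) * deriv g w))\<^sup>2 = 1 / pi * (cmod (deriv g w))\<^sup>2" for w
    by (simp add: norm_mult norm_divide power_mult_distrib power_divide)
  have e2: "(cmod (of_real (sqrt (2 / pi)) * (g w * deriv g w)))\<^sup>2 = 2 / pi * ((cmod (deriv g w))\<^sup>2 * (cmod (g w))\<^sup>2)" for w
    unfolding norm_mult power_mult_distrib norm_of_real by simp
  show "(\<lambda>w. of_real (1 / sqrt pi) * deriv g w) \<in> L2h D"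
    unfolding L2h_def mem_Collect_eq e1
    using 1(1) by (intro conjI holomorphic_intros g' set_integrable_mult_right)
  show "(\<lambda>w. of_real (sqrt (2 / pi)) * (g w * deriv g w)) \<in> L2h D"
    unfolding L2h_def mem_Collect_eq e2
    using 2(1) by (intro conjI holomorphic_intros g' g(1) set_integrable_mult_right)
  show "L2_norm_on D (\<lambda>w. of_real (1 / sqrt pi) * deriv g w) \<le> 1"
    unfolding L2_norm_on_def e1 using 1(2) by (simp add: field_simps)
  show "L2_norm_on D (\<lambda>w. of_real (sqrt (2 / pi)) * (g w * deriv g w)) \<le> 1"
    unfolding L2_norm_on_def e2 using 2(2) by (simp add: field_simps)
qed

text \<open>
  The map \<open>\<phi>\<close> bounds all candidates in the suprema from above and is itself a candidate in the
  infimum; \<open>g\<close> supplies candidates in the suprema and bounds all those in the infimum from below.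
  If \<open>D\<close> is a disc centred at \<open>z\<close> and
  \<open>\<phi>\<close>, \<open>g\<close> are affine maps between \<open>D\<close> and the unit disc, then \<open>L = U\<close> and all four intervals are points.
\<close>
theorem
  assumes D: "open D" "z \<in> D"
    and \<phi>: "\<phi> holomorphic_on ball 0 1" "inj_on \<phi> (ball 0 1)" "\<phi> ` ball 0 1 \<subseteq> D" "\<phi> 0 = z"
    and g: "g holomorphic_on D" "inj_on g D" "g ` D \<subseteq> ball 0 1" "g z = 0"
    and U: "cmod (deriv \<phi> 0) = 1 / U" "U > 0" and L: "cmod (deriv g z) = L"
  shows caratheodory_metric_bounds: "caratheodory_metric D z \<in> {L..U}"
    and kobayashi_metric_bounds: "kobayashi_metric D z \<in> {L..U}"
    and sqrt_bergman_kernel_bounds: "sqrt (pi * bergman_kernel D z) \<in> {L..U}"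
    and bergman_M_bounds: "bergman_M D z \<in> {sqrt (2 / pi) * L\<^sup>2..sqrt (2 / pi) * U\<^sup>2}"
proof -
  have "L \<ge> 0" using L by auto
  have L0: "(\<lambda>_. 0) \<in> L2h D" "L2_norm_on D (\<lambda>_. 0) \<le> 1"
    by (auto simp: L2h_def L2_norm_on_def set_integrable_def set_lebesgue_integral_def)
  let ?C = "{cmod (deriv f z) | f. f holomorphic_on D \<and> f ` D \<subseteq> ball 0 1 \<and> f z = 0}"
  have C: "x \<le> U" if "x \<in> ?C" for x
    using that caratheodory_candidate_le[OF D(1) \<phi>(1,3)] \<phi>(4) U by (auto simp: field_simps)
  have "L \<in> ?C" using g L by blast
  then show "caratheodory_metric D z \<in> {L..U}"
    unfolding caratheodory_metric_def using C
    by (auto intro!: cSup_upper cSup_least bdd_aboveI)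
  let ?K = "{cmod \<alpha> | \<alpha>. \<exists>\<phi>. \<phi> holomorphic_on ball 0 1 \<and> \<phi> ` ball 0 1 \<subseteq> D \<and> \<phi> 0 = z \<and> \<alpha> * deriv \<phi> 0 = 1}"
  have K: "L \<le> x" if x: "x \<in> ?K" for x
  proof -
    obtain \<alpha> \<psi> where \<psi>: "\<psi> holomorphic_on ball 0 1" "\<psi> ` ball 0 1 \<subseteq> D" "\<psi> 0 = z" "\<alpha> * deriv \<psi> 0 = 1" "x = cmod \<alpha>"
      using x by blast
    have "L * cmod (deriv \<psi> 0) \<le> 1"
      using caratheodory_candidate_le[OF D(1) \<psi>(1,2) g(1,3)] \<psi>(3) g(4) L by simp
    moreover have e: "x * cmod (deriv \<psi> 0) = 1"
      using \<psi>(4,5) by (metis norm_mult norm_one)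
    ultimately have "L * cmod (deriv \<psi> 0) \<le> x * cmod (deriv \<psi> 0)" by simp
    moreover have "cmod (deriv \<psi> 0) > 0" using e by (cases "deriv \<psi> 0 = 0") auto
    ultimately show ?thesis by simp
  qed
  have "U \<in> ?K"
  proof -
    have "deriv \<phi> 0 \<noteq> 0" using U by auto
    then have "cmod (1 / deriv \<phi> 0) \<in> ?K"
      using \<phi> by (intro CollectI exI[of _ "1 / deriv \<phi> 0"] exI[of _ \<phi>] conjI) auto
    then show ?thesis using U by (simp add: norm_divide)
  qed
  then show "kobayashi_metric D z \<in> {L..U}"
    unfolding kobayashi_metric_def using K
    by (auto intro!: cInf_lower cInf_greatest bdd_belowI)
  let ?B = "{(cmod (f z))\<^sup>2 | f. f \<in> L2h D \<and> L2_norm_on D f \<le> 1}"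
  have B: "x \<le> U\<^sup>2 / pi" if "x \<in> ?B" for x
    using that L2h_value_le[OF D(1) \<phi>(1,2,3)] U by (auto simp: \<phi>(4) field_simps)
  have "L\<^sup>2 / pi \<in> ?B"
    using deriv_in_L2h[OF D(1) g(1-3)] L2_norm_deriv_le[OF D(1) g(1-3)] L
    by (intro CollectI exI[of _ "\<lambda>w. of_real (1 / sqrt pi) * deriv g w"] conjI)
      (auto simp: norm_mult norm_divide power_divide)
  then have "bergman_kernel D z \<in> {L\<^sup>2 / pi..U\<^sup>2 / pi}"
    unfolding bergman_kernel_def using B
    by (auto intro!: cSup_upper cSup_least bdd_aboveI)
  then have "L\<^sup>2 \<le> pi * bergman_kernel D z" "pi * bergman_kernel D z \<le> U\<^sup>2"
    by (simp_all add: field_simps)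
  then show "sqrt (pi * bergman_kernel D z) \<in> {L..U}"
    using \<open>L \<ge> 0\<close> \<open>U > 0\<close> by (auto intro: real_le_rsqrt real_le_lsqrt)
  let ?M = "{cmod (deriv f z) | f. f \<in> L2h D \<and> L2_norm_on D f \<le> 1 \<and> f z = 0}"
  have M: "x \<le> sqrt (2 / pi) * U\<^sup>2" if x: "x \<in> ?M" for x
  proof -
    obtain f where f: "x = cmod (deriv f z)" "f \<in> L2h D" "L2_norm_on D f \<le> 1" "f z = 0"
      using x by blast
    have "(x * (1 / U)\<^sup>2)\<^sup>2 \<le> 2 / pi"
      using L2h_deriv_le[OF D(1) \<phi>(1,2,3) f(2,3)] U(1) f(1,4) \<phi>(4) by simp
    then have "x * (1 / U)\<^sup>2 \<le> sqrt (2 / pi)"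
      by (rule real_le_rsqrt)
    then show ?thesis using U(2) by (simp add: field_simps)
  qed
  have "sqrt (2 / pi) * L\<^sup>2 \<in> ?M"
  proof (intro CollectI exI conjI)
    let ?f = "\<lambda>w. of_real (sqrt (2 / pi)) * (g w * deriv g w)"
    have "((\<lambda>w. g w * deriv g w) has_field_derivative deriv g z * deriv g z + deriv (deriv g) z * g z) (at z)"
      by (intro DERIV_mult holomorphic_derivI[OF _ D] g(1) holomorphic_deriv[OF g(1) D(1)])
    from DERIV_cmult[OF this, of "of_real (sqrt (2 / pi))"]
    have df: "deriv ?f z = of_real (sqrt (2 / pi)) * (deriv g z * deriv g z)"
      by (intro DERIV_imp_deriv) (simp add: g(4))
    show "sqrt (2 / pi) * L\<^sup>2 = cmod (deriv ?f z)"
      unfolding df norm_mult L norm_of_real by (simp add: power2_eq_square)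
    show "?f \<in> L2h D" "L2_norm_on D ?f \<le> 1" "?f z = 0"
      using times_deriv_in_L2h[OF D(1) g(1-3)] L2_norm_times_deriv_le[OF D(1) g(1-3)] g(4) by auto
  qed
  then show "bergman_M D z \<in> {sqrt (2 / pi) * L\<^sup>2..sqrt (2 / pi) * U\<^sup>2}"
    unfolding bergman_M_def using M
    by (auto intro!: cSup_upper cSup_least bdd_aboveI simp del: real_sqrt_divide)
qed

section \<open>Moebius maps for the inside and the outside of a disc\<close>

lemma cnj_mult_ne_one: "1 - cnj b * w \<noteq> 0" if "cmod b < 1" "cmod w < 1"
proof
  assume "1 - cnj b * w = 0"
  then have "cmod b * cmod w = 1"
    by (metis complex_mod_cnj eq_iff_diff_eq_0 norm_mult norm_one)
  moreover have "cmod b * cmod w < 1 * 1"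
    using that by (intro mult_strict_mono) auto
  ultimately show False by simp
qed

lemma has_field_derivative_Moebius_function:
  assumes "cmod b < 1" "cmod w < 1"
  shows "(Moebius_function 0 b has_field_derivative (1 - cnj b * b) / (1 - cnj b * w)\<^sup>2) (at w)"
  unfolding Moebius_function_simple[abs_def]
  by (rule derivative_eq_intros refl cnj_mult_ne_one[OF assms])+
    (use cnj_mult_ne_one[OF assms] in \<open>simp add: field_simps power2_eq_square\<close>)

lemma inj_on_Moebius_function:
  assumes "cmod b < 1"
  shows "inj_on (Moebius_function 0 b) (ball 0 1)"
  by (rule inj_on_inverseI[of _ "Moebius_function 0 (- b)"]) (use assms Moebius_function_compose[of "-b" b] in auto)

text \<open>
  The derivative is the reciprocal of the hyperbolic density of the disc \<open>ball c R\<close> at \<open>z\<close>.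
\<close>
lemma disc_onto_interior_disc:
  assumes "z \<in> ball c R"
  obtains \<phi> where "\<phi> holomorphic_on ball 0 1" "inj_on \<phi> (ball 0 1)" "\<phi> ` ball 0 1 \<subseteq> ball c R" "\<phi> 0 = z"
    "cmod (deriv \<phi> 0) = (R\<^sup>2 - (dist z c)\<^sup>2) / R"
proof
  define b where "b = (c - z) / of_real R"
  define \<phi> where "\<phi> = (\<lambda>w. c + of_real R * Moebius_function 0 b w)"
  have R: "R > 0" using assms by (metis ball_eq_empty empty_iff linorder_not_less)
  have b: "cmod b < 1"
    using assms R by (simp add: b_def norm_divide dist_norm field_simps)
  show "\<phi> holomorphic_on ball 0 1"
    unfolding \<phi>_def by (intro holomorphic_intros Moebius_function_holomorphic b)
  show "inj_on \<phi> (ball 0 1)"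
    using inj_on_Moebius_function[OF b] R by (auto simp: inj_on_def \<phi>_def)
  show "\<phi> ` ball 0 1 \<subseteq> ball c R"
    using Moebius_function_norm_lt_1[OF b] R by (auto simp: \<phi>_def dist_norm norm_mult)
  show "\<phi> 0 = z"
    using R by (simp add: \<phi>_def Moebius_function_simple b_def)
  have "(\<phi> has_field_derivative of_real R * (1 - cnj b * b)) (at 0)"
    unfolding \<phi>_def using has_field_derivative_Moebius_function[OF b, of 0]
    by (auto intro!: derivative_eq_intros)
  then have "deriv \<phi> 0 = of_real R * (1 - cnj b * b)"
    by (rule DERIV_imp_deriv)
  also have "1 - cnj b * b = of_real (1 - (cmod b)\<^sup>2)"
    by (metis complex_norm_square mult.commute of_real_1 of_real_diff)
  finally have "cmod (deriv \<phi> 0) = R * (1 - (cmod b)\<^sup>2)"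
    using R b by (simp add: norm_mult power_le_one abs_of_nonneg del: of_real_diff)
  also have "\<dots> = (R\<^sup>2 - (dist z c)\<^sup>2) / R"
    using R by (simp add: b_def norm_divide power_divide dist_norm norm_minus_commute field_simps power2_eq_square)
  finally show "cmod (deriv \<phi> 0) = (R\<^sup>2 - (dist z c)\<^sup>2) / R" .
qed

text \<open>
  The inversion \<open>\<zeta> \<mapsto> R / (\<zeta> - c)\<close> maps the complement of the closed disc into the unit disc. As \<open>D\<close>
  is open it avoids the closed disc as soon as it avoids the open one.
\<close>
lemma exterior_of_disc_into_disc:
  assumes D: "open D" "z \<in> D" and R: "R > 0" and disj: "D \<inter> ball c R = {}"
  obtains g where "g holomorphic_on D" "inj_on g D" "g ` D \<subseteq> ball 0 1" "g z = 0"
    "cmod (deriv g z) = R / ((dist z c)\<^sup>2 - R\<^sup>2)"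
proof
  define h where "h = (\<lambda>\<zeta>. of_real R / (\<zeta> - c))"
  define b where "b = h z"
  define g where "g = (\<lambda>\<zeta>. Moebius_function 0 b (h \<zeta>))"
  have "D \<inter> closure (ball c R) = {}"
    using open_Int_closure_eq_empty[OF D(1)] disj by blast
  then have "D \<inter> cball c R = {}"
    using R by simp
  then have far: "cmod (\<zeta> - c) > R" if "\<zeta> \<in> D" for \<zeta>
    using that by (auto simp: dist_norm norm_minus_commute not_le[symmetric])
  have ne: "\<zeta> - c \<noteq> 0" if "\<zeta> \<in> D" for \<zeta>
    using far[OF that] R by auto
  have h: "h holomorphic_on D" "inj_on h D" "h ` D \<subseteq> ball 0 1"
    unfolding h_def using R ne far
    by (auto intro!: holomorphic_intros simp: inj_on_def norm_divide divide_simps)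
  have b: "cmod b < 1"
    using h(3) D(2) by (auto simp: b_def)
  show "g holomorphic_on D"
    using holomorphic_on_compose_gen[OF h(1) Moebius_function_holomorphic[OF b] h(3)]
    by (simp add: g_def o_def)
  show "inj_on g D"
    using comp_inj_on[OF h(2) inj_on_subset[OF inj_on_Moebius_function[OF b] h(3)]]
    by (simp add: g_def o_def)
  show "g ` D \<subseteq> ball 0 1"
    using Moebius_function_norm_lt_1[OF b] h(3) by (auto simp: g_def image_subset_iff)
  show "g z = 0"
    by (simp add: g_def b_def Moebius_function_eq_zero)
  have "(h has_field_derivative - of_real R / (z - c)\<^sup>2) (at z)"
    unfolding h_def by (rule derivative_eq_intros refl ne D)+ (simp add: power2_eq_square)
  then have "(g has_field_derivative (1 - cnj b * b) / (1 - cnj b * h z)\<^sup>2 * (- of_real R / (z - c)\<^sup>2)) (at z)"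
    unfolding g_def
    by (intro DERIV_chain2[OF has_field_derivative_Moebius_function]) (use b in \<open>auto simp: b_def\<close>)
  then have "deriv g z = (1 - cnj b * b) / (1 - cnj b * b)\<^sup>2 * (- of_real R / (z - c)\<^sup>2)"
    by (intro DERIV_imp_deriv) (simp add: b_def)
  also have "1 - cnj b * b = of_real (1 - (cmod b)\<^sup>2)"
    by (metis complex_norm_square mult.commute of_real_1 of_real_diff)
  finally have "deriv g z = of_real (1 - (cmod b)\<^sup>2) / (of_real (1 - (cmod b)\<^sup>2))\<^sup>2 * (- of_real R / (z - c)\<^sup>2)" .
  moreover have "1 - (cmod b)\<^sup>2 > 0"
    using b by (simp add: power_less_one_iff)
  ultimately have "cmod (deriv g z) = 1 / (1 - (cmod b)\<^sup>2) * (R / (cmod (z - c))\<^sup>2)"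
    using R by (simp only: norm_mult norm_divide norm_power norm_minus_cancel norm_of_real)
      (simp add: power2_eq_square)
  also have "\<dots> = R / ((dist z c)\<^sup>2 - R\<^sup>2)"
    using R far[OF D(2)] ne[OF D(2)] by (simp add: b_def h_def norm_divide dist_norm divide_simps)
  finally show "cmod (deriv g z) = R / ((dist z c)\<^sup>2 - R\<^sup>2)" .
qed

section \<open>Flatness of Hoelder-smooth curves\<close>

text \<open>
  For \<open>Y \<le> d\<close> the first term suffices. For \<open>Y \<ge> d\<close> the second one does, as \<open>Y\<^bsup>\<epsilon>-1\<^esup>\<close> decreases in
  \<open>Y\<close>; this is where \<open>\<epsilon> \<le> 1\<close> is needed.
\<close>
lemma powr_le_powr_plus_square:
  fixes d Y \<epsilon> :: real
  assumes "0 < \<epsilon>" "\<epsilon> \<le> 1" "d > 0" "Y \<ge> 0"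
  shows "Y powr (1 + \<epsilon>) \<le> d powr (1 + \<epsilon>) + d powr (\<epsilon> - 1) * Y\<^sup>2"
proof (cases "Y \<le> d")
  case True
  then have "Y powr (1 + \<epsilon>) \<le> d powr (1 + \<epsilon>)"
    using assms by (intro powr_mono2) auto
  moreover have "0 \<le> d powr (\<epsilon> - 1) * Y\<^sup>2" by simp
  ultimately show ?thesis by linarith
next
  case False
  then have Y: "Y > 0" "d \<le> Y" using assms by auto
  have "Y powr (1 + \<epsilon>) = Y powr (\<epsilon> - 1) * Y\<^sup>2"
    using Y by (simp flip: powr_numeral powr_add)
  also have "\<dots> \<le> d powr (\<epsilon> - 1) * Y\<^sup>2"
    using assms Y by (intro mult_right_mono powr_mono2') auto
  also have "\<dots> \<le> d powr (1 + \<epsilon>) + d powr (\<epsilon> - 1) * Y\<^sup>2" by simp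
  finally show ?thesis .
qed

text \<open>
  Here \<open>Re w\<close> and \<open>Im w\<close> are the normal and the tangential coordinate of a boundary point. The disc has
  radius \<open>R = d / (2 x)\<close> and its lowest point is at height \<open>\<delta> = d x\<close>. It lies above the parabola
  \<open>Re w = \<delta> + (Im w)\<^sup>2 / (2 R) = C (d\<^bsup>1+\<epsilon>\<^esup> + d\<^bsup>\<epsilon>-1\<^esup> (Im w)\<^sup>2)\<close>, which in turn lies above the region
  allowed for boundary points.
\<close>
lemma flat_point_not_in_ball:
  fixes w :: complex
  assumes \<epsilon>: "0 < \<epsilon>" "\<epsilon> \<le> 1" and d: "d > 0" and C: "C > 0"
    and flat: "\<bar>Re w\<bar> \<le> C * \<bar>Im w\<bar> powr (1 + \<epsilon>)"
    and x: "x = C * d powr \<epsilon>"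
  shows "w \<notin> ball (of_real (d / (2 * x) + d * x)) (d / (2 * x))"
proof
  define R where "R = d / (2 * x)"
  define \<delta> where "\<delta> = d * x"
  have x0: "x > 0" using C d by (simp add: x)
  then have R: "R > 0" using d by (simp add: R_def)
  assume "w \<in> ball (of_real (d / (2 * x) + d * x)) (d / (2 * x))"
  then have "cmod (w - of_real (R + \<delta>)) < R"
    by (simp add: R_def \<delta>_def dist_norm norm_minus_commute)
  then have "(cmod (w - of_real (R + \<delta>)))\<^sup>2 < R\<^sup>2"
    using R by (intro power_strict_mono) auto
  then have "(Re w - \<delta>)\<^sup>2 + (Im w)\<^sup>2 < 2 * R * (Re w - \<delta>)"
    unfolding cmod_power2 by (simp add: power2_eq_square algebra_simps)
  then have "(Im w)\<^sup>2 < 2 * R * (Re w - \<delta>)"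
    by (smt (verit) zero_le_power2)
  then have "(Im w)\<^sup>2 / (2 * R) < Re w - \<delta>"
    using R by (simp add: field_simps)
  moreover have "(Im w)\<^sup>2 / (2 * R) = C * (d powr (\<epsilon> - 1) * \<bar>Im w\<bar>\<^sup>2)"
    using d C by (simp add: R_def x powr_diff field_simps)
  moreover have "\<delta> = C * d powr (1 + \<epsilon>)"
    using d by (simp add: \<delta>_def x powr_add)
  ultimately have "C * (d powr (1 + \<epsilon>) + d powr (\<epsilon> - 1) * \<bar>Im w\<bar>\<^sup>2) < Re w"
    by (simp add: algebra_simps)
  moreover have "C * \<bar>Im w\<bar> powr (1 + \<epsilon>) \<le> C * (d powr (1 + \<epsilon>) + d powr (\<epsilon> - 1) * \<bar>Im w\<bar>\<^sup>2)"
    using C powr_le_powr_plus_square[OF \<epsilon> d, of "\<bar>Im w\<bar>"] by (intro mult_left_mono) auto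
  ultimately show False using flat by linarith
qed

lemma holder_curve_taylor:
  fixes \<gamma> :: "real \<Rightarrow> complex"
  assumes der: "\<And>t. t \<in> {0..1} \<Longrightarrow> (\<gamma> has_vector_derivative \<gamma>' t) (at t within {0..1})"
    and holder: "\<And>s t. s \<in> {0..1} \<Longrightarrow> t \<in> {0..1} \<Longrightarrow> cmod (\<gamma>' s - \<gamma>' t) \<le> C * \<bar>s - t\<bar> powr \<epsilon>"
    and "C \<ge> 0" "\<epsilon> > 0" and st: "s \<in> {0..1}" "t \<in> {0..1}"
  shows "cmod (\<gamma> t - \<gamma> s - (t - s) *\<^sub>R \<gamma>' s) \<le> C * \<bar>t - s\<bar> powr (1 + \<epsilon>)"
proof -
  let ?S = "closed_segment s t"
  have sub: "?S \<subseteq> {0..1}"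
    using st by (intro closed_segment_subset) auto
  have "norm (\<gamma> t - \<gamma> s - (\<lambda>h. h *\<^sub>R \<gamma>' s) (t - s)) \<le> norm (t - s) * (C * \<bar>t - s\<bar> powr \<epsilon>)"
  proof (rule differentiable_bound_linearization[where S = ?S and f' = "\<lambda>u h. h *\<^sub>R \<gamma>' u"])
    show "s + u *\<^sub>R (t - s) \<in> ?S" if "u \<in> {0..1}" for u
      using that unfolding closed_segment_def
      by (auto intro!: exI[of _ u] simp: algebra_simps)
    show "(\<gamma> has_derivative (\<lambda>h. h *\<^sub>R \<gamma>' u)) (at u within ?S)" if "u \<in> ?S" for u
      using der[of u] sub that unfolding has_vector_derivative_def
      by (intro has_derivative_subset[OF _ sub]) auto
    show "onorm ((\<lambda>h. h *\<^sub>R \<gamma>' u) - (\<lambda>h. h *\<^sub>R \<gamma>' s)) \<le> C * \<bar>t - s\<bar> powr \<epsilon>" if "u \<in> ?S" for u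
      unfolding fun_diff_def
    proof (rule onorm_bound)
      show "0 \<le> C * \<bar>t - s\<bar> powr \<epsilon>" using \<open>C \<ge> 0\<close> by simp
      fix v :: real
      have "cmod (\<gamma>' u - \<gamma>' s) \<le> C * \<bar>u - s\<bar> powr \<epsilon>"
        using sub that st by (intro holder) auto
      also have "\<dots> \<le> C * \<bar>t - s\<bar> powr \<epsilon>"
        using that \<open>C \<ge> 0\<close> \<open>\<epsilon> > 0\<close>
        by (intro mult_left_mono powr_mono2) (auto simp: closed_segment_eq_real_ivl split: if_splits)
      finally show "norm (v *\<^sub>R \<gamma>' u - v *\<^sub>R \<gamma>' s) \<le> C * \<bar>t - s\<bar> powr \<epsilon> * norm v"
        by (simp flip: scaleR_diff_right add: mult_right_mono mult.commute[of _ "\<bar>v\<bar>"] mult_left_mono)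
    qed
  qed simp
  then show ?thesis
    by (cases "t = s") (simp_all add: powr_add mult_ac)
qed

lemma small_powr_multiple:
  fixes C \<epsilon> b :: real
  assumes "\<epsilon> > 0" "b > 0"
  obtains \<eta> where "\<eta> > 0" "\<And>x. 0 \<le> x \<Longrightarrow> x \<le> \<eta> \<Longrightarrow> C * x powr \<epsilon> \<le> b"
proof
  let ?C = "max C 1"
  let ?\<eta> = "(b / ?C) powr (1 / \<epsilon>)"
  show "?\<eta> > 0" using assms by (auto simp: max_def)
  fix x :: real assume x: "0 \<le> x" "x \<le> ?\<eta>"
  have "C * x powr \<epsilon> \<le> ?C * x powr \<epsilon>" by (intro mult_right_mono) auto
  also have "\<dots> \<le> ?C * ?\<eta> powr \<epsilon>"
    using x assms by (intro mult_left_mono powr_mono2) auto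
  also have "\<dots> = b"
    using assms by (simp add: powr_powr max_def)
  finally show "C * x powr \<epsilon> \<le> b" .
qed

text \<open>
  Every sufficiently close piece of the curve is flat to order \<open>1 + \<epsilon>\<close> with respect to the tangent
  at any of its points, uniformly in that point. The quotient by \<open>\<i> sgn (\<gamma>' s)\<close> has the coordinate
  along the left unit normal at \<open>\<gamma> s\<close> as real part and minus the tangential coordinate as imaginary part.
  Taylor expansion bounds the former by a multiple of \<open>\<bar>t - s\<bar>\<^bsup>1+\<epsilon>\<^esup>\<close>; the latter
  is at least a multiple of \<open>\<bar>t - s\<bar>\<close>, because \<open>\<bar>\<gamma>'\<bar>\<close> is bounded below near \<open>\<tau>\<close>. Injectivity and
  compactness keep the rest of the curve away from \<open>\<gamma> \<tau>\<close>, so closeness in the plane implies closeness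
  of the parameters.
\<close>
lemma holder_curve_flat_near_point:
  fixes \<gamma> :: "real \<Rightarrow> complex"
  assumes \<epsilon>: "\<epsilon> > 0"
    and der: "\<And>t. t \<in> {0..1} \<Longrightarrow> (\<gamma> has_vector_derivative \<gamma>' t) (at t within {0..1})"
    and nz: "\<And>t. t \<in> {0..1} \<Longrightarrow> \<gamma>' t \<noteq> 0"
    and holder: "holder_on \<epsilon> {0..1} \<gamma>'" and inj: "inj_on \<gamma> {0..1}" and \<tau>: "\<tau> \<in> {0<..<1}"
  obtains C r where "C > 0" "r > 0"
    "\<And>s t. s \<in> {0..1} \<Longrightarrow> t \<in> {0..1} \<Longrightarrow> \<gamma> s \<in> ball (\<gamma> \<tau>) r \<Longrightarrow> \<gamma> t \<in> ball (\<gamma> \<tau>) r \<Longrightarrow>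
      \<bar>Re ((\<gamma> t - \<gamma> s) / (\<i> * sgn (\<gamma>' s)))\<bar> \<le> C * \<bar>Im ((\<gamma> t - \<gamma> s) / (\<i> * sgn (\<gamma>' s)))\<bar> powr (1 + \<epsilon>)"
    "\<And>t. t \<in> {0..1} \<Longrightarrow> \<gamma> t \<in> ball (\<gamma> \<tau>) r \<Longrightarrow> t \<in> {0<..<1}"
proof -
  obtain C' where C': "\<forall>s\<in>{0..1}. \<forall>t\<in>{0..1}. cmod (\<gamma>' s - \<gamma>' t) \<le> C' * \<bar>s - t\<bar> powr \<epsilon>"
    using holder unfolding holder_on_def by blast
  define C where "C = max C' 1"
  have C1: "C \<ge> 1" by (simp add: C_def)
  have C: "cmod (\<gamma>' s - \<gamma>' t) \<le> C * \<bar>s - t\<bar> powr \<epsilon>" if "s \<in> {0..1}" "t \<in> {0..1}" for s t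
  proof -
    have "cmod (\<gamma>' s - \<gamma>' t) \<le> C' * \<bar>s - t\<bar> powr \<epsilon>" using C' that by blast
    also have "\<dots> \<le> C * \<bar>s - t\<bar> powr \<epsilon>" by (intro mult_right_mono) (auto simp: C_def)
    finally show ?thesis .
  qed
  define m where "m = cmod (\<gamma>' \<tau>) / 2"
  have m: "m > 0" using nz[of \<tau>] \<tau> by (simp add: m_def)
  \<comment> \<open>\<open>\<eta>'\<close> must serve for \<open>\<bar>t - s\<bar>\<close>, which can be as large as \<open>2 \<eta>\<close>.\<close>
  obtain \<eta>' where \<eta>': "\<eta>' > 0" "\<And>x. 0 \<le> x \<Longrightarrow> x \<le> \<eta>' \<Longrightarrow> C * x powr \<epsilon> \<le> m / 2"
    using small_powr_multiple[OF \<epsilon>, of "m / 2" C] m by auto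
  define \<eta> where "\<eta> = min (\<eta>' / 2) (min \<tau> (1 - \<tau>))"
  have \<eta>: "\<eta> > 0" "\<eta> \<le> \<tau>" "\<eta> \<le> 1 - \<tau>" "2 * \<eta> \<le> \<eta>'"
    using \<eta>'(1) \<tau> by (auto simp: \<eta>_def min_def)
  let ?K = "{0..1} - {\<tau> - \<eta><..<\<tau> + \<eta>}"
  have cont: "continuous_on {0..1} \<gamma>"
    using der has_vector_derivative_continuous by (fastforce simp: continuous_on_eq_continuous_within)
  have "compact (\<gamma> ` ?K)"
    by (intro compact_continuous_image continuous_on_subset[OF cont] compact_diff) auto
  then have "open (- (\<gamma> ` ?K))"
    using compact_imp_closed by blast
  moreover have "\<gamma> \<tau> \<notin> \<gamma> ` ?K"
    using inj \<tau> \<eta>(1) by (auto dest!: inj_onD)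
  ultimately obtain r where r: "r > 0" "ball (\<gamma> \<tau>) r \<subseteq> - (\<gamma> ` ?K)"
    by (meson ComplI openE)
  have near: "\<bar>t - \<tau>\<bar> < \<eta>" if "t \<in> {0..1}" "\<gamma> t \<in> ball (\<gamma> \<tau>) r" for t
  proof (rule ccontr)
    assume "\<not> \<bar>t - \<tau>\<bar> < \<eta>"
    then have "\<gamma> t \<in> \<gamma> ` ?K"
      using that(1) by (intro imageI) auto
    then show False using r(2) that(2) by blast
  qed
  show thesis
  proof (rule that[of "C * (2 / m) powr (1 + \<epsilon>)" r])
    show "0 < C * (2 / m) powr (1 + \<epsilon>)" using C1 m by simp
    show "r > 0" by fact
    show "t \<in> {0<..<1}" if "t \<in> {0..1}" "\<gamma> t \<in> ball (\<gamma> \<tau>) r" for t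
      using near[OF that] \<eta> by auto
    fix s t assume st: "s \<in> {0..1}" "t \<in> {0..1}" and "\<gamma> s \<in> ball (\<gamma> \<tau>) r" "\<gamma> t \<in> ball (\<gamma> \<tau>) r"
    then have n: "\<bar>s - \<tau>\<bar> < \<eta>" "\<bar>t - \<tau>\<bar> < \<eta>" using near by auto
    define n where "n = \<i> * sgn (\<gamma>' s)"
    define w where "w = (\<gamma> t - \<gamma> s) / n"
    define e where "e = (\<gamma> t - \<gamma> s - (t - s) *\<^sub>R \<gamma>' s) / n"
    define u where "u = \<bar>t - s\<bar>"
    have g0: "\<gamma>' s \<noteq> 0" using nz st by blast
    then have cn: "cmod n = 1" by (simp add: n_def norm_mult norm_sgn)
    have gn: "\<gamma>' s / n = - \<i> * cmod (\<gamma>' s)"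
      using g0 by (simp add: n_def sgn_eq field_simps)
    have we: "w = e - \<i> * of_real ((t - s) * cmod (\<gamma>' s))"
      using gn by (simp add: w_def e_def diff_divide_distrib scaleR_conv_of_real flip: times_divide_eq_right)
    have e: "cmod e \<le> C * u powr (1 + \<epsilon>)"
      using holder_curve_taylor[OF der C _ \<epsilon> st] C1 cn by (simp add: e_def norm_divide u_def)
    have uu: "0 \<le> u" "u \<le> 2 * \<eta>" "\<bar>s - \<tau>\<bar> \<le> \<eta>'" using n \<eta> by (auto simp: u_def)
    have "cmod (\<gamma>' \<tau> - \<gamma>' s) \<le> C * \<bar>\<tau> - s\<bar> powr \<epsilon>" using \<tau> st by (intro C) auto
    also have "\<dots> \<le> m / 2" using uu by (intro \<eta>') auto
    finally have "cmod (\<gamma>' s) \<ge> cmod (\<gamma>' \<tau>) - m / 2"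
      using norm_triangle_ineq2[of "\<gamma>' \<tau>" "\<gamma>' s"] by linarith
    then have gm: "cmod (\<gamma>' s) \<ge> m"
      using norm_ge_zero[of "\<gamma>' s"] unfolding m_def by linarith
    have "C * u powr (1 + \<epsilon>) = (C * u powr \<epsilon>) * u"
      using uu(1) by (cases "u = 0") (auto simp: powr_add mult_ac)
    also have "\<dots> \<le> m / 2 * u"
      using uu \<eta> by (intro mult_right_mono \<eta>') auto
    finally have "cmod e \<le> m / 2 * u" using e by linarith
    then have "\<bar>Im e\<bar> \<le> m / 2 * u" using abs_Im_le_cmod[of e] by linarith
    moreover have "\<bar>(t - s) * cmod (\<gamma>' s)\<bar> \<ge> m * u"
      using mult_right_mono[OF gm uu(1)] by (simp add: u_def abs_mult mult.commute)
    moreover have "Im w = Im e - (t - s) * cmod (\<gamma>' s)" by (simp add: we)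
    ultimately have "\<bar>Im w\<bar> \<ge> m / 2 * u" by linarith
    then have u_le: "u \<le> 2 / m * \<bar>Im w\<bar>" using m by (simp add: field_simps)
    have "\<bar>Re w\<bar> = \<bar>Re e\<bar>" by (simp add: we)
    also have "\<dots> \<le> C * u powr (1 + \<epsilon>)" using abs_Re_le_cmod[of e] e by linarith
    also have "\<dots> \<le> C * (2 / m * \<bar>Im w\<bar>) powr (1 + \<epsilon>)"
      using C1 \<epsilon> uu u_le by (intro mult_left_mono powr_mono2) auto
    also have "\<dots> = C * (2 / m) powr (1 + \<epsilon>) * \<bar>Im w\<bar> powr (1 + \<epsilon>)"
      using m by (subst powr_mult) auto
    finally show "\<bar>Re ((\<gamma> t - \<gamma> s) / (\<i> * sgn (\<gamma>' s)))\<bar>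
        \<le> C * (2 / m) powr (1 + \<epsilon>) * \<bar>Im ((\<gamma> t - \<gamma> s) / (\<i> * sgn (\<gamma>' s)))\<bar> powr (1 + \<epsilon>)"
      by (simp add: w_def n_def)
  qed
qed

section \<open>Discs on both sides of the boundary\<close>

lemma connected_avoiding_frontier:
  assumes "connected S" "S \<inter> frontier D = {}" "S \<inter> D \<noteq> {}"
  shows "S \<subseteq> D"
  using connected_Int_frontier[OF assms(1,3)] assms(2) by blast

text \<open>
  The derivative of \<open>t \<mapsto> \<bar>\<gamma> t - z\<bar>\<^sup>2\<close> vanishes at the minimum.
\<close>
lemma foot_point_is_normal:
  fixes \<gamma> :: "real \<Rightarrow> complex"
  assumes der: "(\<gamma> has_vector_derivative v) (at s)"
    and min: "\<forall>\<^sub>F t in nhds s. dist z (\<gamma> s) \<le> dist z (\<gamma> t)"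
  shows "(z - \<gamma> s) \<bullet> v = 0"
proof -
  have "((\<lambda>t. (\<gamma> t - z) \<bullet> (\<gamma> t - z)) has_derivative
      (\<lambda>h. (\<gamma> s - z) \<bullet> (h *\<^sub>R v) + (h *\<^sub>R v) \<bullet> (\<gamma> s - z))) (at s)"
    using der unfolding has_vector_derivative_def
    by (auto intro!: derivative_eq_intros)
  also have "(\<lambda>h. (\<gamma> s - z) \<bullet> (h *\<^sub>R v) + (h *\<^sub>R v) \<bullet> (\<gamma> s - z)) = (*) (2 * ((\<gamma> s - z) \<bullet> v))"
    by (auto simp: inner_commute)
  finally have "((\<lambda>t. (\<gamma> t - z) \<bullet> (\<gamma> t - z)) has_real_derivative 2 * ((\<gamma> s - z) \<bullet> v)) (at s)"
    by (simp add: has_field_derivative_def)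
  moreover obtain e where "e > 0" "\<And>t. dist t s < e \<Longrightarrow> dist z (\<gamma> s) \<le> dist z (\<gamma> t)"
    using min unfolding eventually_nhds_metric by blast
  moreover from this have "\<forall>t. \<bar>s - t\<bar> < e \<longrightarrow> (\<gamma> s - z) \<bullet> (\<gamma> s - z) \<le> (\<gamma> t - z) \<bullet> (\<gamma> t - z)"
    by (simp add: dist_norm norm_minus_commute dot_square_norm power_mono abs_minus_commute)
  ultimately have "2 * ((\<gamma> s - z) \<bullet> v) = 0"
    by (intro DERIV_local_min) auto
  then show ?thesis
    by (simp add: inner_diff_left)
qed

text \<open>
  Here \<open>p\<close> stands for a boundary point and \<open>n\<close> for the unit normal there that points into \<open>D\<close>. Dividing by \<open>n\<close> turns the
  normal into the real axis and the tangent into the imaginary one. The last clause fixes the side: it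
  keeps \<open>D\<close> from lying on both sides of its boundary.
\<close>
definition flat_frontier_frame :: "real \<Rightarrow> real \<Rightarrow> complex set \<Rightarrow> complex set \<Rightarrow> complex \<Rightarrow> complex \<Rightarrow> bool"
  where "flat_frontier_frame \<epsilon> C B D p n \<longleftrightarrow> cmod n = 1 \<and>
    (\<forall>q\<in>frontier D \<inter> B. \<bar>Re ((q - p) / n)\<bar> \<le> C * \<bar>Im ((q - p) / n)\<bar> powr (1 + \<epsilon>)) \<and>
    (\<forall>\<^sub>F s in at_right 0. p - of_real s * n \<notin> D)"

text \<open>
  Near a smooth boundary point, with \<open>p\<close> a point of the boundary nearest to \<open>z\<close>. As \<open>z - p\<close> is
  orthogonal to the curve, \<open>z = p \<plusminus> d n\<close> for the left normal \<open>n\<close>. The minus sign is impossible: the disc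
  of radius \<open>d\<close> around \<open>z\<close> lies in \<open>D\<close>, but the points just right of \<open>p\<close> do not.
\<close>
lemma smooth_boundary_point_frames:
  assumes "\<epsilon> > 0" and a: "a \<in> frontier D" and smooth: "C1_smooth_boundary_point \<epsilon> D a"
  obtains C r where "C > 0" "r > 0"
    "\<And>z. z \<in> D \<Longrightarrow> dist z a < r / 8 \<Longrightarrow> bdist D z > 0 \<Longrightarrow>
      \<exists>p n. dist p a < r / 4 \<and> z = p + of_real (bdist D z) * n \<and> flat_frontier_frame \<epsilon> C (ball a r) D p n"
proof -
  obtain \<gamma> \<gamma>' U where
    der_nz: "\<forall>t\<in>{0..1}. (\<gamma> has_vector_derivative \<gamma>' t) (at t within {0..1}) \<and> \<gamma>' t \<noteq> 0"
    and holder: "holder_on \<epsilon> {0..1} \<gamma>'" and inj: "inj_on \<gamma> {0..1}"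
    and a\<gamma>: "a \<in> \<gamma> ` {0<..<1}" and U: "open U" "a \<in> U"
    and fr: "frontier D \<inter> U = \<gamma> ` {0..1} \<inter> U"
    and side: "\<forall>t\<in>{0..1}. \<gamma> t \<in> U \<longrightarrow>
          (\<forall>\<^sub>F s in at_right 0. \<gamma> t + of_real s * (\<i> * \<gamma>' t) \<in> D \<and> \<gamma> t - of_real s * (\<i> * \<gamma>' t) \<notin> D)"
    using smooth unfolding C1_smooth_boundary_point_def by (elim exE conjE) (rule that; assumption)
  have der: "(\<gamma> has_vector_derivative \<gamma>' t) (at t within {0..1})" and nz: "\<gamma>' t \<noteq> 0" if "t \<in> {0..1}" for t
    using der_nz that by auto
  obtain \<tau> where \<tau>: "\<tau> \<in> {0<..<1}" "a = \<gamma> \<tau>" using a\<gamma> by blast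
  obtain C r0 where C: "C > 0" "r0 > 0" and
    flat: "\<And>s t. s \<in> {0..1} \<Longrightarrow> t \<in> {0..1} \<Longrightarrow> \<gamma> s \<in> ball (\<gamma> \<tau>) r0 \<Longrightarrow> \<gamma> t \<in> ball (\<gamma> \<tau>) r0 \<Longrightarrow>
      \<bar>Re ((\<gamma> t - \<gamma> s) / (\<i> * sgn (\<gamma>' s)))\<bar> \<le> C * \<bar>Im ((\<gamma> t - \<gamma> s) / (\<i> * sgn (\<gamma>' s)))\<bar> powr (1 + \<epsilon>)"
    and inner: "\<And>t. t \<in> {0..1} \<Longrightarrow> \<gamma> t \<in> ball (\<gamma> \<tau>) r0 \<Longrightarrow> t \<in> {0<..<1}"
    by (rule holder_curve_flat_near_point[OF \<open>\<epsilon> > 0\<close> der nz holder inj \<tau>(1)])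
      (assumption, assumption, (rule that; assumption))
  note flat = flat[folded \<tau>(2)] and inner = inner[folded \<tau>(2)]
  obtain r1 where r1: "r1 > 0" "ball a r1 \<subseteq> U" using U openE by blast
  define r where "r = min r0 r1"
  have r: "r > 0" "ball a r \<subseteq> U" "ball a r \<subseteq> ball a r0" using C r1 by (auto simp: r_def)
  have "\<exists>p n. dist p a < r / 4 \<and> z = p + of_real (bdist D z) * n \<and> flat_frontier_frame \<epsilon> C (ball a r) D p n"
    if z: "z \<in> D" "dist z a < r / 8" "bdist D z > 0" for z
  proof -
    define d where "d = bdist D z"
    have dist_frontier: "d \<le> dist z q" if "q \<in> frontier D" for q
      using that by (simp add: d_def bdist_def infdist_le)
    obtain p where p: "p \<in> frontier D" "d = dist z p"
      using infdist_attains_inf[of "frontier D" z] a by (auto simp: d_def bdist_def)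
    have "d < r / 8" using dist_frontier[OF a] z by simp
    then have pa: "dist p a < r / 4"
      using dist_triangle[of p a z] p(2) z(2) by (simp add: dist_commute)
    then have pb: "p \<in> ball a r" using r(1) by (simp add: dist_commute)
    then obtain s where s: "s \<in> {0..1}" "p = \<gamma> s" using fr p(1) r(2) by blast
    have s01: "s \<in> {0<..<1}" using inner[OF s(1)] s(2) pb r(3) by blast
    have "at s within {0..1} = at s"
      using s01 by (intro at_within_interior) (auto simp: interior_atLeastAtMost_real)
    then have der_s: "(\<gamma> has_vector_derivative \<gamma>' s) (at s)"
      using der[OF s(1)] by simp
    have "isCont \<gamma> s"
      using has_vector_derivative_continuous[OF der_s] .
    then have lim: "(\<gamma> \<longlongrightarrow> p) (nhds s)"
      by (simp add: s(2) continuous_within tendsto_at_iff_tendsto_nhds)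
    have "\<forall>\<^sub>F t in nhds s. dist z (\<gamma> s) \<le> dist z (\<gamma> t)"
    proof -
      have "\<forall>\<^sub>F t in nhds s. \<gamma> t \<in> U"
        using topological_tendstoD[OF lim U(1)] pb r(2) by blast
      moreover have "\<forall>\<^sub>F t in nhds s. t \<in> {0<..<1}"
        by (rule eventually_nhds_in_open[OF _ s01]) simp
      ultimately show ?thesis
      proof eventually_elim
        case (elim t)
        then have "\<gamma> t \<in> \<gamma> ` {0..1} \<inter> U" by auto
        then have "\<gamma> t \<in> frontier D" using fr by blast
        then show ?case using dist_frontier p(2) s(2) by auto
      qed
    qed
    then have orth: "(z - p) \<bullet> \<gamma>' s = 0"
      using foot_point_is_normal[OF der_s] s(2) by simp
    define n where "n = \<i> * sgn (\<gamma>' s)"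
    have nz_s: "\<gamma>' s \<noteq> 0" using nz s(1) by blast
    then have n: "cmod n = 1" by (simp add: n_def norm_mult norm_sgn)
    have n': "\<i> * \<gamma>' s = of_real (cmod (\<gamma>' s)) * n"
      using nz_s by (simp add: n_def sgn_eq)
    define u where "u = (z - p) / n"
    have zu: "z = p + u * n" using n by (auto simp: u_def)
    have "Im u = 0"
    proof -
      have "\<gamma>' s = of_real (cmod (\<gamma>' s)) * (- \<i> * n)"
        using n' by (metis (no_types, lifting) complex_i_mult_minus mult.left_commute mult_minus_left mult_minus_right minus_minus)
      then have "(z - p) \<bullet> \<gamma>' s = cmod (\<gamma>' s) * ((u * n) \<bullet> (- \<i> * n))"
        unfolding zu by (metis add_diff_cancel_left' inner_scaleR_right scaleR_conv_of_real)
      also have "(u * n) \<bullet> (- \<i> * n) = - Im u * (cmod n)\<^sup>2"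
        unfolding cmod_power2 by (simp add: inner_complex_def algebra_simps power2_eq_square)
      finally show ?thesis using orth nz_s n by simp
    qed
    moreover have "cmod u = d"
      using p(2) n by (simp add: u_def norm_divide dist_norm)
    ultimately have u: "u = of_real d \<or> u = - of_real d"
      by (auto simp: complex_eq_iff cmod_def)
    obtain b where b: "b > 0" "\<And>t. 0 < t \<Longrightarrow> t < b \<Longrightarrow> p - of_real t * (\<i> * \<gamma>' s) \<notin> D"
    proof -
      have "\<forall>\<^sub>F t in at_right 0. p - of_real t * (\<i> * \<gamma>' s) \<notin> D"
      proof (rule eventually_mono)
        have "\<gamma> s \<in> U" using s(2) pb r(2) by blast
        then show "\<forall>\<^sub>F t in at_right 0. \<gamma> s + of_real t * (\<i> * \<gamma>' s) \<in> D \<and> \<gamma> s - of_real t * (\<i> * \<gamma>' s) \<notin> D"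
          using side s(1) by blast
      qed (simp add: s(2))
      then show ?thesis
        unfolding eventually_at_right_field using that by blast
    qed
    have out: "p - of_real t * n \<notin> D" if "0 < t" "t < b * cmod (\<gamma>' s)" for t
    proof -
      have "p - of_real (t / cmod (\<gamma>' s)) * (\<i> * \<gamma>' s) \<notin> D"
        using that nz_s by (intro b(2)) (auto simp: field_simps)
      then show ?thesis unfolding n' using nz_s by simp
    qed
    have "\<forall>\<^sub>F t in at_right 0. p - of_real t * n \<notin> D"
      unfolding eventually_at_right_field using out b(1) nz_s
      by (intro exI[of _ "b * cmod (\<gamma>' s)"]) auto
    moreover have "u = of_real d"
    proof (rule ccontr)
      assume "u \<noteq> of_real d"
      then have um: "u = - of_real d" using u by blast
      have "ball z d \<subseteq> D"
      proof (rule connected_avoiding_frontier)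
        show "ball z d \<inter> frontier D = {}" using dist_frontier by fastforce
        have "z \<in> ball z d" using z(3) by (simp add: d_def)
        then show "ball z d \<inter> D \<noteq> {}" using z(1) by blast
      qed simp
      define t where "t = min (d / 2) (b * cmod (\<gamma>' s) / 2)"
      have t: "0 < t" "t < d" "t < b * cmod (\<gamma>' s)"
        using z(3) b(1) nz_s by (auto simp: t_def d_def[symmetric] min_less_iff_disj)
      have "z - (p - of_real t * n) = of_real (t - d) * n"
        by (simp add: zu um algebra_simps)
      then have "dist z (p - of_real t * n) = d - t"
        using n t by (simp only: dist_norm norm_mult norm_of_real) simp
      then have "p - of_real t * n \<in> ball z d" using t by simp
      then show False using \<open>ball z d \<subseteq> D\<close> out t by blast
    qed
    moreover have "\<bar>Re ((q - p) / n)\<bar> \<le> C * \<bar>Im ((q - p) / n)\<bar> powr (1 + \<epsilon>)"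
      if q: "q \<in> frontier D \<inter> ball a r" for q
    proof -
      obtain t where "t \<in> {0..1}" "q = \<gamma> t" using fr q r(2) by blast
      then show ?thesis
        using flat[OF s(1), of t] q pb r(3) s(2) unfolding n_def by blast
    qed
    ultimately show ?thesis
      using pa n zu unfolding flat_frontier_frame_def d_def by blast
  qed
  then show thesis using that C(1) r(1) by blast
qed

text \<open>
  Neither disc meets the boundary by \<open>flat_point_not_in_ball\<close>, applied in the frame \<open>n\<close> for the inner
  disc and in the frame \<open>- n\<close> for the outer one. A connected set that avoids the boundary lies on one
  side of it. The inner disc contains \<open>z\<close>. The outer disc need not contain a point
  known to be outside \<open>D\<close>, so it is joined to \<open>p\<close> by a segment along the normal; this segment
  avoids the boundary since its points have tangential coordinate \<open>0\<close>.
\<close>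
lemma discs_on_both_sides:
  assumes \<epsilon>: "0 < \<epsilon>" "\<epsilon> \<le> 1" and d: "d > 0" and C: "C > 0"
    and z: "z \<in> D" "z = p + of_real d * n"
    and frame: "flat_frontier_frame \<epsilon> C B D p n"
    and x: "x = C * d powr \<epsilon>" "x < 1"
    and B: "ball p (d / x + d * x) \<subseteq> B"
  shows "ball (p + of_real (d / (2 * x) + d * x) * n) (d / (2 * x)) \<subseteq> D" (is ?A)
    and "D \<inter> ball (p - of_real (d / (2 * x) + d * x) * n) (d / (2 * x)) = {}" (is ?B)
proof -
  define h where "h = d / (2 * x) + d * x"
  define R where "R = d / (2 * x)"
  have x0: "x > 0" using C d x by simp
  have hR: "h + R = d / x + d * x" by (simp add: h_def R_def)
  have "d * x > 0" "d * x < d" "d < d / x"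
    using d x0 x(2) by (auto simp: field_simps)
  moreover have "R > 0"
    using d x0 by (simp add: R_def)
  moreover have "h = R + d * x"
    by (simp add: R_def h_def)
  ultimately have R: "R > 0" "h > 0" "h < R + d" "d < h + R"
    using hR by linarith+
  have n: "cmod n = 1" using frame by (simp add: flat_frontier_frame_def)
  then have n0: "n \<noteq> 0" by auto
  have flat: "\<bar>Re ((q - p) / n)\<bar> \<le> C * \<bar>Im ((q - p) / n)\<bar> powr (1 + \<epsilon>)" if "q \<in> frontier D" "q \<in> B" for q
    using frame that by (auto simp: flat_frontier_frame_def)
  have sub: "ball (p + of_real k * n) R \<subseteq> B" if "\<bar>k\<bar> = h" for k
  proof
    fix q assume q: "q \<in> ball (p + of_real k * n) R"
    have "dist p (p + of_real k * n) = h" using that n by (simp add: dist_norm norm_mult)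
    then have "dist p q < h + R" using q dist_triangle[of p q "p + of_real k * n"] by (simp add: dist_commute)
    then show "q \<in> B" using B hR by auto
  qed
  have no: "q \<notin> ball (p + of_real k * n) R" if q: "q \<in> frontier D" and k: "k = h \<or> k = - h" for q k
  proof
    assume qb: "q \<in> ball (p + of_real k * n) R"
    then have "q \<in> B" using sub[of k] k R(2) by (metis abs_minus_cancel abs_of_pos subsetD)
    define w where "w = (q - p) / n"
    have q_eq: "q = p + w * n" using n0 by (simp add: w_def)
    have "dist (p + of_real k * n) q = cmod (of_real k * n - w * n)"
      unfolding q_eq by (simp add: dist_norm)
    also have "\<dots> = cmod (of_real k - w)"
      using n by (simp add: norm_mult flip: left_diff_distrib)
    finally have kw: "cmod (of_real k - w) < R" using qb by simp
    have "cmod (of_real h - w) < R \<or> cmod (of_real h - (- w)) < R"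
      using k kw norm_minus_cancel[of "of_real h + w"] by auto
    moreover have "w \<notin> ball (of_real h) R" "- w \<notin> ball (of_real h) R"
      unfolding h_def R_def using flat[OF q \<open>q \<in> B\<close>, folded w_def]
      by (intro flat_point_not_in_ball[OF \<epsilon> d C _ x(1)]; simp)+
    ultimately show False by (simp add: dist_norm)
  qed
  have "ball (p + of_real h * n) R \<subseteq> D"
  proof (rule connected_avoiding_frontier)
    show "ball (p + of_real h * n) R \<inter> frontier D = {}" using no by blast
    have "p + of_real h * n - z = of_real (h - d) * n" by (simp add: z(2) algebra_simps)
    then have "dist (p + of_real h * n) z = \<bar>h - d\<bar>"
      using n by (simp only: dist_norm norm_mult norm_of_real) simp
    then have "z \<in> ball (p + of_real h * n) R" using R by auto
    then show "ball (p + of_real h * n) R \<inter> D \<noteq> {}" using z(1) by blast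
  qed simp
  then show ?A by (simp add: h_def R_def)
  \<comment> \<open>the half-open segment from \<open>p\<close>, excluded, to the centre of the outer disc\<close>
  define T where "T = (\<lambda>s. p - of_real s * n) ` {0<..h}"
  obtain b where b: "b > 0" "\<And>s. 0 < s \<Longrightarrow> s < b \<Longrightarrow> p - of_real s * n \<notin> D"
    using frame unfolding flat_frontier_frame_def eventually_at_right_field by auto
  let ?S = "T \<union> ball (p - of_real h * n) R"
  have "?S \<subseteq> - D"
  proof (rule connected_avoiding_frontier)
    have "connected T" unfolding T_def
      by (intro connected_continuous_image continuous_intros) simp
    moreover have "p - of_real h * n \<in> T \<inter> ball (p - of_real h * n) R"
      using R by (auto simp: T_def)
    ultimately show "connected ?S"
      by (intro connected_Un) auto
    have "T \<inter> frontier D = {}"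
    proof (rule ccontr)
      assume "T \<inter> frontier D \<noteq> {}"
      then obtain s where s: "0 < s" "s \<le> h" "p - of_real s * n \<in> frontier D"
        by (auto simp: T_def)
      have "dist p (p - of_real s * n) < h + R"
        using s R n by (simp add: dist_norm norm_mult)
      then have "p - of_real s * n \<in> B" using B hR by auto
      from flat[OF s(3) this] show False using n0 s(1) by simp
    qed
    moreover have "ball (p - of_real h * n) R \<inter> frontier D = {}"
      using no[of _ "- h"] by auto
    ultimately show "?S \<inter> frontier (- D) = {}" by (simp add: Int_Un_distrib2)
    define s where "s = min (b / 2) h"
    have "0 < s" "s < b" "s \<le> h" using b(1) R by (auto simp: s_def)
    then have "p - of_real s * n \<in> T \<inter> - D" using b(2) by (auto simp: T_def)
    then show "?S \<inter> - D \<noteq> {}" by blast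
  qed
  then show ?B by (auto simp: h_def R_def)
qed

section \<open>The boundary estimate\<close>

lemma upper_factor_le:
  fixes x :: real
  assumes "0 < x" "x \<le> 1 / 8"
  shows "1 / ((1 - x) * (1 - x + x\<^sup>2)) \<le> 1 + 4 * x"
proof -
  have "1 \<le> (1 + 4 * x) * (1 - 2 * x)"
    using mult_left_mono[OF assms(2), of x] assms by (simp add: algebra_simps)
  also have "\<dots> \<le> (1 + 4 * x) * ((1 - x) * (1 - x + x\<^sup>2))"
  proof (rule mult_left_mono)
    have "x * (x * x) \<le> x * x"
      using assms by (simp add: mult_left_le_one_le)
    moreover have "(1 - x) * (1 - x + x\<^sup>2) = 1 - 2 * x + 2 * (x * x) - x * (x * x)"
      by (simp add: algebra_simps power2_eq_square)
    moreover have "x * x \<ge> 0" by simp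
    ultimately show "1 - 2 * x \<le> (1 - x) * (1 - x + x\<^sup>2)" by linarith
  qed (use assms in auto)
  finally show ?thesis
    using assms by (subst pos_divide_le_eq) (auto intro!: mult_pos_pos add_pos_nonneg)
qed

lemma lower_factor_ge:
  fixes x :: real
  assumes "0 < x" "x \<le> 1 / 8"
  shows "1 - 4 * x \<le> 1 / ((1 + x) * (1 + x + x\<^sup>2))"
proof -
  have xx: "x * x \<le> x / 8" "x * (x * x) \<le> x * x"
    using mult_left_mono[OF assms(2), of x] assms by (simp_all add: mult_left_le_one_le)
  have "(1 + x) * (1 + x + x\<^sup>2) = 1 + 2 * x + 2 * (x * x) + x * (x * x)"
    by (simp add: algebra_simps power2_eq_square)
  then have "(1 + x) * (1 + x + x\<^sup>2) \<le> 1 + 4 * x"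
    using xx assms by linarith
  then have "(1 - 4 * x) * ((1 + x) * (1 + x + x\<^sup>2)) \<le> (1 - 4 * x) * (1 + 4 * x)"
    using assms by (intro mult_left_mono) auto
  also have "\<dots> \<le> 1" by (simp add: algebra_simps)
  finally show ?thesis
    using assms by (subst pos_le_divide_eq) (auto intro!: mult_pos_pos add_pos_nonneg)
qed

text \<open>
  For the Bergman metric: after multiplication by powers of \<open>2 d\<close>, \<open>M\<close> lies between
  \<open>(1 - 4 x)\<^sup>2\<close> and \<open>(1 + 4 x)\<^sup>2\<close>, and \<open>k\<close> between \<open>1 - 4 x\<close> and \<open>1 + 4 x\<close>.
\<close>
lemma ratio_near_one:
  fixes d x k M :: real
  assumes d: "d > 0" and x: "0 < x" "x \<le> 1 / 8"
    and k: "k \<in> {(1 - 4 * x) / (2 * d)..(1 + 4 * x) / (2 * d)}"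
    and M: "M \<in> {((1 - 4 * x) / (2 * d))\<^sup>2..((1 + 4 * x) / (2 * d))\<^sup>2}"
  shows "\<bar>2 * (M / k) * d - 1\<bar> \<le> 40 * x"
proof -
  define k' where "k' = 2 * d * k"
  define M' where "M' = (2 * d)\<^sup>2 * M"
  have k': "1 - 4 * x \<le> k'" "k' \<le> 1 + 4 * x"
    using k d by (auto simp: k'_def field_simps)
  have M': "(1 - 4 * x)\<^sup>2 \<le> M'" "M' \<le> (1 + 4 * x)\<^sup>2"
    using M d by (auto simp: M'_def power_divide field_simps)
  have pos: "k' > 0" using k' x by linarith
  have "k > 0" using pos d by (simp add: k'_def zero_less_mult_iff)
  then have eq: "2 * (M / k) * d = M' / k'"
    using d by (simp add: M'_def k'_def field_simps power2_eq_square)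
  have xx: "x * x \<le> x / 8"
    using mult_left_mono[OF x(2), of x] x by simp
  have "(1 + 4 * x)\<^sup>2 = 1 + 8 * x + 16 * (x * x)" "(1 + 40 * x) * (1 - 4 * x) = 1 + 36 * x - 160 * (x * x)"
    by (simp_all add: algebra_simps power2_eq_square)
  then have "(1 + 4 * x)\<^sup>2 \<le> (1 + 40 * x) * (1 - 4 * x)"
    using xx x by linarith
  also have "\<dots> \<le> (1 + 40 * x) * k'"
    using k' x by (intro mult_left_mono) auto
  finally have 1: "M' / k' \<le> 1 + 40 * x"
    using M' pos by (simp add: pos_divide_le_eq)
  have "(1 - 40 * x) * k' \<le> (1 - 4 * x)\<^sup>2"
  proof (cases "1 - 40 * x \<ge> 0")
    case True
    then have "(1 - 40 * x) * k' \<le> (1 - 40 * x) * (1 + 4 * x)"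
      using k' by (intro mult_left_mono) auto
    also have "\<dots> \<le> (1 - 4 * x)\<^sup>2"
      using x by (simp add: algebra_simps power2_eq_square)
    finally show ?thesis .
  next
    case False
    then have "(1 - 40 * x) * k' \<le> 0"
      using pos by (intro mult_nonpos_nonneg) auto
    also have "\<dots> \<le> (1 - 4 * x)\<^sup>2" by simp
    finally show ?thesis .
  qed
  then have 2: "1 - 40 * x \<le> M' / k'"
    using M' pos by (simp add: pos_le_divide_eq)
  show ?thesis using 1 2 eq by (simp add: abs_le_iff)
qed

text \<open>
  With \<open>s = d (1 \<mp> x)\<close> for the distance of \<open>z\<close> to the inner or outer circle, the two Moebius maps give
  \<open>1 / (2 s (1 \<mp> s / (2 R)))\<close>, and \<open>s / (2 R) = x (1 \<mp> x)\<close>. So \<open>2 d U\<close> and \<open>2 d L\<close> are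
  \<open>1 / ((1 \<mp> x) (1 \<mp> x + x\<^sup>2))\<close>.
\<close>
lemma metric_estimate_between_discs:
  assumes D: "open D" "z \<in> D" and d: "d > 0" and x: "0 < x" "x \<le> 1 / 8"
    and inner: "ball c R \<subseteq> D" "dist z c = R + d * x - d"
    and outer: "D \<inter> ball c' R = {}" "dist z c' = R + d * x + d"
    and R: "R = d / (2 * x)"
    and m: "m \<in> {caratheodory_metric D, kobayashi_metric D,
               (\<lambda>z. bergman_metric D z / sqrt 2), (\<lambda>z. sqrt (pi * bergman_kernel D z))}"
  shows "\<bar>2 * m z * d - 1\<bar> \<le> 40 * x"
proof -
  have R0: "R > 0" using d x by (simp add: R)
  have "z \<in> ball c R"
    using inner(2) d x by (simp add: dist_commute)
  then obtain \<phi> where \<phi>: "\<phi> holomorphic_on ball 0 1" "inj_on \<phi> (ball 0 1)" "\<phi> ` ball 0 1 \<subseteq> ball c R" "\<phi> 0 = z"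
    and d\<phi>: "cmod (deriv \<phi> 0) = (R\<^sup>2 - (dist z c)\<^sup>2) / R"
    by (rule disc_onto_interior_disc)
  obtain g where g: "g holomorphic_on D" "inj_on g D" "g ` D \<subseteq> ball 0 1" "g z = 0"
    and dg: "cmod (deriv g z) = R / ((dist z c')\<^sup>2 - R\<^sup>2)"
    by (rule exterior_of_disc_into_disc[OF D R0 outer(1)])
  define U where "U = 1 / (2 * d * ((1 - x) * (1 - x + x\<^sup>2)))"
  define L where "L = 1 / (2 * d * ((1 + x) * (1 + x + x\<^sup>2)))"
  have p: "(1 - x) * (1 - x + x\<^sup>2) > 0" "(1 + x) * (1 + x + x\<^sup>2) > 0"
    using x by (auto intro!: mult_pos_pos add_pos_nonneg)
  have U0: "U > 0" using p d by (simp add: U_def)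
  have dU: "cmod (deriv \<phi> 0) = 1 / U"
    unfolding d\<phi> inner(2) R U_def using d x by (simp add: field_simps power2_eq_square)
  have iL: "((dist z c')\<^sup>2 - R\<^sup>2) / R = 1 / L"
    unfolding outer(2) R L_def using d x by (simp add: field_simps power2_eq_square)
  have dL: "cmod (deriv g z) = L"
    using arg_cong[OF iL, of inverse] unfolding dg by (simp only: inverse_divide div_by_1)
  have "L \<ge> (1 - 4 * x) / (2 * d)"
    using mult_left_mono[OF lower_factor_ge[OF x], of "1 / (2 * d)"] d by (simp add: L_def)
  moreover have "U \<le> (1 + 4 * x) / (2 * d)"
    using mult_left_mono[OF upper_factor_le[OF x], of "1 / (2 * d)"] d by (simp add: U_def)
  ultimately have LU: "(1 - 4 * x) / (2 * d) \<le> L" "U \<le> (1 + 4 * x) / (2 * d)" .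
  have L0: "0 \<le> (1 - 4 * x) / (2 * d)" using x d by simp
  have \<phi>D: "\<phi> ` ball 0 1 \<subseteq> D" using \<phi>(3) inner(1) by blast
  note bounds = caratheodory_metric_bounds kobayashi_metric_bounds sqrt_bergman_kernel_bounds bergman_M_bounds
  note bounds = bounds[OF D \<phi>(1,2) \<phi>D \<phi>(4) g dU U0 dL]
  have simple: "\<bar>2 * k * d - 1\<bar> \<le> 40 * x" if "k \<in> {L..U}" for k
  proof -
    have "(1 - 4 * x) / (2 * d) \<le> k" "k \<le> (1 + 4 * x) / (2 * d)" using that LU by auto
    then have "1 - 4 * x \<le> 2 * k * d" "2 * k * d \<le> 1 + 4 * x"
      using d by (auto simp: field_simps)
    then show ?thesis using x by (simp add: abs_le_iff)
  qed
  have bergman: "\<bar>2 * (bergman_metric D z / sqrt 2) * d - 1\<bar> \<le> 40 * x"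
  proof -
    define k where "k = sqrt (pi * bergman_kernel D z)"
    define M where "M = bergman_M D z / sqrt (2 / pi)"
    have k: "k \<in> {L..U}" using bounds(3) by (simp add: k_def)
    have "M \<in> {L\<^sup>2..U\<^sup>2}" using bounds(4) by (auto simp: M_def pos_le_divide_eq pos_divide_le_eq mult.commute simp del: real_sqrt_divide)
    moreover have "((1 - 4 * x) / (2 * d))\<^sup>2 \<le> L\<^sup>2" "U\<^sup>2 \<le> ((1 + 4 * x) / (2 * d))\<^sup>2"
      using LU L0 U0 by (auto intro!: power_mono)
    ultimately have "M \<in> {((1 - 4 * x) / (2 * d))\<^sup>2..((1 + 4 * x) / (2 * d))\<^sup>2}" by auto
    moreover have "k \<in> {(1 - 4 * x) / (2 * d)..(1 + 4 * x) / (2 * d)}" using k LU by auto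
    ultimately have "\<bar>2 * (M / k) * d - 1\<bar> \<le> 40 * x"
      by (intro ratio_near_one[OF d x])
    moreover have "bergman_metric D z / sqrt 2 = M / k"
      by (simp add: bergman_metric_def M_def k_def real_sqrt_mult real_sqrt_divide)
    ultimately show ?thesis by simp
  qed
  show ?thesis
    using m simple bounds(1-3) bergman by auto
qed

theorem proposition3:
  fixes \<epsilon> :: real and D :: "complex set" and a :: complex and m :: "complex \<Rightarrow> real"
  assumes "0 < \<epsilon>" and "\<epsilon> \<le> 1"
    and "open D" and "connected D"
    and "a \<in> frontier D"
    and "C1_smooth_boundary_point \<epsilon> D a"
    and "m \<in> {caratheodory_metric D, kobayashi_metric D,
               (\<lambda>z. bergman_metric D z / sqrt 2), (\<lambda>z. sqrt (pi * bergman_kernel D z))}"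
  shows "\<exists>U. open U \<and> a \<in> U \<and>
           bounded ((\<lambda>z. (2 * m z * bdist D z - 1) / bdist D z powr \<epsilon>) ` (D \<inter> U))"
proof -
  obtain C0 r where C0: "C0 > 0" and r: "r > 0" and
    frames: "\<And>z. z \<in> D \<Longrightarrow> dist z a < r / 8 \<Longrightarrow> bdist D z > 0 \<Longrightarrow>
      \<exists>p n. dist p a < r / 4 \<and> z = p + of_real (bdist D z) * n \<and> flat_frontier_frame \<epsilon> C0 (ball a r) D p n"
    using smooth_boundary_point_frames[OF assms(1,5,6)] by blast
  \<comment> \<open>Enlarging the flatness constant only shrinks the discs; \<open>4 / r\<close> makes their diameter
    \<open>d / x \<le> 1 / C\<close> small enough to stay in \<open>ball a r\<close>, which matters for \<open>\<epsilon> = 1\<close>, where it does not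
    tend to \<open>0\<close> with \<open>d\<close>.\<close>
  define C where "C = max C0 (4 / r)"
  have C: "C > 0" "C \<ge> C0" "1 / C \<le> r / 4"
    using C0 r by (auto simp: C_def field_simps max_def)
  obtain \<eta> where \<eta>: "\<eta> > 0" "\<And>t. 0 \<le> t \<Longrightarrow> t \<le> \<eta> \<Longrightarrow> C * t powr \<epsilon> \<le> 1 / 8"
    using small_powr_multiple[OF assms(1), of "1 / 8" C] by auto
  define \<rho> where "\<rho> = min (min 1 (r / 8)) \<eta>"
  have \<rho>: "\<rho> > 0" "\<rho> \<le> 1" "\<rho> \<le> r / 8" "\<rho> \<le> \<eta>" using r \<eta> by (auto simp: \<rho>_def)
  have "\<bar>(2 * m z * bdist D z - 1) / bdist D z powr \<epsilon>\<bar> \<le> 40 * C" if z: "z \<in> D" "dist z a < \<rho>" for z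
  proof -
    define d where "d = bdist D z"
    define x where "x = C * d powr \<epsilon>"
    have "z \<notin> frontier D" using assms(3) z(1) by (simp add: frontier_def interior_open)
    then have d: "d > 0"
      using assms(5) infdist_pos_not_in_closed[of "frontier D" z] by (auto simp: d_def bdist_def)
    have "d \<le> dist z a" using assms(5) by (simp add: d_def bdist_def infdist_le)
    then have d\<rho>: "d < \<rho>" using z by simp
    have x: "0 < x" "x \<le> 1 / 8" using d C \<eta>(2)[of d] d\<rho> \<rho> by (auto simp: x_def)
    obtain p n where pn: "dist p a < r / 4" "z = p + of_real d * n" "flat_frontier_frame \<epsilon> C0 (ball a r) D p n"
      using frames[OF z(1)] z(2) \<rho> d unfolding d_def by force
    have frame: "flat_frontier_frame \<epsilon> C (ball a r) D p n"
      using pn(3) C(2) unfolding flat_frontier_frame_def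
      by (meson mult_right_mono order_trans powr_ge_zero)
    have n: "cmod n = 1" using frame by (simp add: flat_frontier_frame_def)
    have "d / x = d powr (1 - \<epsilon>) / C"
      using d by (simp add: x_def powr_diff field_simps)
    also have "\<dots> \<le> 1 / C"
      using d d\<rho> \<rho> assms(2) C by (intro divide_right_mono powr_le1) auto
    also have "\<dots> \<le> r / 4" by (rule C)
    finally have "d / x \<le> r / 4" .
    moreover have "d * x \<le> r / 4"
      using mult_mono[of d "r / 8" x 1] d d\<rho> \<rho> x r by auto
    ultimately have small: "d / x + d * x \<le> r / 2" by linarith
    have B: "ball p (d / x + d * x) \<subseteq> ball a r"
    proof
      fix q assume "q \<in> ball p (d / x + d * x)"
      then have "dist p q < d / x + d * x" by simp
      then have "dist p q < r / 2" using small by linarith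
      then show "q \<in> ball a r"
        using pn(1) dist_triangle[of a q p] r by (simp add: dist_commute)
    qed
    have "x < 1" using x by simp
    note discs = discs_on_both_sides[OF assms(1,2) d C(1) z(1) pn(2) frame x_def this B]
    define h where "h = d / (2 * x) + d * x"
    have "d \<le> d / (2 * x)" using d x by (simp add: field_simps)
    then have hd: "h \<ge> d" using d x by (simp add: h_def add_increasing2)
    have "z - (p + of_real h * n) = of_real (d - h) * n" "z - (p - of_real h * n) = of_real (d + h) * n"
      by (simp_all add: pn(2) algebra_simps)
    then have "dist z (p + of_real h * n) = h - d" "dist z (p - of_real h * n) = h + d"
      using hd d n by (simp_all only: dist_norm norm_mult norm_of_real) simp_all
    then have "\<bar>2 * m z * d - 1\<bar> \<le> 40 * x"
      using discs unfolding h_def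
      by (intro metric_estimate_between_discs[OF assms(3) z(1) d x _ _ _ _ refl assms(7)]) auto
    then show ?thesis
      using d by (simp add: d_def[symmetric] x_def pos_divide_le_eq mult.assoc)
  qed
  then show ?thesis
    using \<rho>(1)
    by (intro exI[of _ "ball a \<rho>"]) (auto simp: bounded_iff dist_commute intro!: exI[of _ "40 * C"])
qed

end
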